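(* Let $(X,\|\cdot\|)$ be a real normed space, $X\neq\{0\}$. Suppose that $b:X\to(-\infty,\infty]$ is convex and lower semicontinuous, and that $U:=\mathrm{Int}(\mathrm{dom}(b))$ is nonempty. Assume also that $b$ is Gâteaux differentiable in $U$. Let $B:X^2\to(-\infty,\infty]$ be defined by $B(x,y):=b(x)-b(y)-\langle b'(y),x-y\rangle$ for $(x,y)\in\mathrm{dom}(b)\times U$ and $B(x,y):=\infty$ otherwise. Let $S_1$ and $S_2$ be nonempty subsets of $\mathrm{dom}(b)$. Then the following properties hold. (I) Given $x\in\mathrm{dom}(b)$, $y\in U$ and a relative gauge $\psi$ of $b$ on $(\{x\},\{y\})$ (the modulus of uniform convexity $\psi_{b,\{x\},\{y\}}$ of $b$ relative to $(\{x\},\{y\})$ or any other relative gauge), we have $\psi(\|x-y\|)\le B(x,y)$. In particular, if $S_2\cap U\ne\emptyset$ and $b$ is uniformly convex relative to $(S_1,S_2\cap U)$ with some relative gauge $\psi$, then $\psi(\|x-y\|)\le B(x,y)$ for each $(x,y)\in S_1\times(S_2\cap U)$. Specifying even further, if $S_2\cap U\neq\emptyset$ and $b$ is uniformly convex relative to $(S_1,S_2\cap U)$ with some relative gauge $\psi$ which is strictly increasing and continuous on some interval $J\subseteq[0,\infty)$ having the property that $\psi(J)$ contains $B(x,y)$ for each $(x,y)\in S_1\times(S_2\cap U)$, then $\|x-y\|\le\psi^{-1}(B(x,y))$ for each $(x,y)\in S_1\times(S_2\cap U)$. (II) For each $y\in U$, the function $x\mapsto B(x,y)$, $x\in X$,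 is convex and lower semicontinuous. In addition, if $b$ is uniformly convex relative to $(S_1,S_2)$ with a gauge $\psi$, then for each $y\in U$ the function $x\mapsto B(x,y)$, $x\in X$, is uniformly convex relative to $(S_1,S_2)$ with the same gauge $\psi$. (III) If $x=y\in U$, then $B(x,y)=0$. Furthermore, $B(x,y)\ge0$ for each $x\in X$ and $y\in X$. If, in addition, $b$ is strictly convex on the open interval $(x,y)$ for some $x\in\mathrm{dom}(b)$ and $y\in U$ satisfying $x\ne y$, then $B(x,y)>0$. In particular, if $b$ is strictly convex on $U$, and $x\in\mathrm{dom}(b)$ and $y\in U$ are given, then $B(x,y)=0$ if and only if $x=y$. (IV) Assume that $b$ is uniformly convex on a nonempty and convex subset $S$ of $\mathrm{dom}(b)$ satisfying $S\cap U\neq\emptyset$. Let $(x_i)$ be a sequence in $S$ and $(y_i)$ a sequence in $S\cap U$. If $\lim_{i\to\infty} B(x_i,y_i)=0$, then $\lim_{i\to\infty}\|x_i-y_i\|=0$. (V) Suppose that $b$ is uniformly convex on every nonempty, bounded and convex subset of $\mathrm{dom}(b)$. Then given two sequences $(x_i)$ in $\mathrm{dom}(b)$ and $(y_i)$ in $U$ satisfying $\lim_{i\to\infty}B(x_i,y_i)=0$, if one of these sequences is bounded, then the other sequence is bounded too and, moreover, $\lim_{i\to\infty}\|x_i-y_i\|=0$. In particular, $b$ is sequentially consistent. Specializing even further, under the same assumption on $b$, if $(x_i)$ is in $\mathrm{dom}(b)$ and $(y_i)$ is in $U$, and one of these sequences converges strongly to some $z\in\overline{\mathrm{dom}(b)}$,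 and also $\lim_{i\to\infty}B(x_i,y_i)=0$, then the other sequence converges strongly to $z$ too. (VI) Suppose that $b$ is continuous on $\mathrm{dom}(b)$ and strictly convex on $U$ and that $b'$ is continuous on $U$. Let $(x_i)$ be a sequence in $X$ which is contained in a compact subset of $\mathrm{dom}(b)$ (in particular, this condition holds when $X$ is finite-dimensional and $(x_i)$ is bounded). Let $(y_i)$ be a sequence in $U$ such that $\lim_{i\to\infty}\|y_i-y\|=0$ for some $y\in U$. If $\lim_{i\to\infty} B(x_i,y_i)=0$, then $\lim_{i\to\infty}\|x_i-y\|=0$. (VII) Suppose that $(x_i)$ is a bounded sequence in $\mathrm{dom}(b)$ and $(y_i)$ is a sequence in $U$ which is contained in a compact subset of $\overline{\mathrm{dom}(b)}$ (in particular, this condition is satisfied if $X$ is finite-dimensional and $(y_i)$ is bounded). If $B$ is a Bregman divergence and $\lim_{i\to\infty} B(x_i,y_i)=0$, then $\lim_{i\to\infty}\|x_i-y_i\|=0$. (VIII) Assume that $b'$ is bounded on all the subsets of $U$ which are bounded and convex. Let $(x_i)$ and $(y_i)$ be sequences of elements of $U$. If one of these sequences is bounded and $\lim_{i\to\infty}\|x_i-y_i\|=0$, then $\lim_{i\to\infty} B(x_i,y_i)=0$. (IX) Suppose that $b$ is continuous on $\mathrm{dom}(b)$ and that $b'$ is bounded on all bounded and convex subsets of $U$. Let $(x_i)$ be a sequence in $\mathrm{dom}(b)$ and $(y_i)$ a sequence in $U$, where one of these sequences is bounded. If $\lim_{i\to\infty}\|x_i-y_i\|=0$, then $\lim_{i\to\infty}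 B(x_i,y_i)=0$. In particular, if $b$ is continuous on $\mathrm{dom}(b)$ and $b'$ is uniformly continuous on all bounded and convex subsets of $U$, then given a sequence $(y_i)$ in $U$ which converges to some $x\in\mathrm{dom}(b)$, we have $\lim_{i\to\infty} B(x,y_i)=0$. (X) Suppose that $b$ is continuous on $U$ and that $b'$ is locally bounded at each point of $U$. If $(y_i)$ is a sequence in $U$ which satisfies $\lim_{i\to\infty}\|x-y_i\|=0$ for some $x\in U$, then $\lim_{i\to\infty} B(x,y_i)=0$. In particular, if $X$ is finite-dimensional and $b$ is merely assumed to satisfy the general assumptions made at the beginning (convex, lower semicontinuous, $U\ne\emptyset$, Gâteaux differentiable in $U$), then for every sequence $(y_i)$ in $U$ which converges to some $x\in U$, we have $\lim_{i\to\infty} B(x,y_i)=0$. (XI) Suppose that $b$ is continuous on $\mathrm{dom}(b)$ and that for each $x\in\mathrm{dom}(b)$ and each sequence $(y_i)$ in $U$ which converges in norm to $x$, the relation $\lim_{i\to\infty}\langle b'(y_i),x-y_i\rangle=0$ holds. Given a sequence $(y_i)$ in $U$, if $\lim_{i\to\infty}\|x-y_i\|=0$ for some $x\in\mathrm{dom}(b)$, then $\lim_{i\to\infty} B(x,y_i)=0$. (XII) Let $S\subseteq U$ be nonempty. Suppose that $x\in U$ and $\sup\{\|x-y\|:y\in S\}<\infty$. If $b'$ is bounded on all bounded and convex subsets of $U$, then $\sup\{B(x,y):y\in S\}<\infty$. (XIII) Let $S\subseteq U$ be nonempty and let $x\in\mathrm{dom}(b)$. Assume that $\sup\{\|x-y\|:y\in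 S\}<\infty$, that $b$ is continuous on $\mathrm{dom}(b)$, and that $b'$ is bounded on all bounded and convex subsets of $U$. Then $\sup\{B(x,y):y\in S\}<\infty$. (XIV) Let $\emptyset\ne S\subseteq U$ and $x\in\mathrm{dom}(b)$ be given. Assume that $S=S'\cup S''$ where $S'$ is bounded (and possibly empty) and $S''$ is contained in a nonempty subset $V$ of $U$ such that $b$ is uniformly convex relative to $(\{x\},V)$ with a gauge $\psi$ which satisfies $\lim_{t\to\infty}\psi(t)=\infty$. Suppose that $\sup\{B(x,y):y\in S\}<\infty$. Then $S$ is bounded. Similarly, given $\emptyset\ne S\subseteq\mathrm{dom}(b)$ and $y\in U$, if $S=S'\cup S''$ where $S'$ is bounded (and possibly empty) and $S''$ is contained in a nonempty subset $W$ of $\mathrm{dom}(b)$ such that $b$ is uniformly convex relative to $(W,\{y\})$ with a gauge $\psi$ which satisfies $\lim_{t\to\infty}\psi(t)=\infty$, and, in addition, $\sup\{B(x,y):x\in S\}<\infty$, then $S$ is bounded. (XV) Suppose that for each $x\in\mathrm{dom}(b)$ there exists $r_x\ge0$ such that the subset $U\cap\{w\in X:\|w\|\ge r_x\}$ is nonempty and $b$ is uniformly convex relative to $(\{x\},U\cap\{w\in X:\|w\|\ge r_x\})$ with a gauge $\psi_x$ which satisfies $\lim_{t\to\infty}\psi_x(t)=\infty$. Then for each $x\in\mathrm{dom}(b)$ and each $\gamma\in[0,\infty)$, the first type level-set $L_1(x,\gamma):=\{y\in U:B(x,y)\le\gamma\}$ is bounded. Moreover, if, given $x\in\mathrm{dom}(b)$,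 the gauge $\psi_x$ satisfies $\psi_x(0)=0$, and it is continuous and strictly increasing on $[0,\infty)$, then $\max\{2\psi_x^{-1}(\gamma),2r_x,\psi_x^{-1}(\gamma)+r_x+\|x\|\}$ is an upper bound on the diameter of $L_1(x,\gamma)$. Similarly, if for each $y\in U$ there exists $r_y\ge0$ such that the subset $\{w\in\mathrm{dom}(b):\|w\|\ge r_y\}$ is nonempty and $b$ is uniformly convex relative to $(\{w\in\mathrm{dom}(b):\|w\|\ge r_y\},\{y\})$ with a gauge $\psi_y$ which satisfies $\lim_{t\to\infty}\psi_y(t)=\infty$, then for each $y\in\mathrm{dom}(b)$ and each $\gamma\in[0,\infty)$ the second type level-set $L_2(y,\gamma):=\{x\in\mathrm{dom}(b):B(x,y)\le\gamma\}$ is bounded. Moreover, if, given $y\in U$, the gauge $\psi_y$ satisfies $\psi_y(0)=0$, and it is continuous and strictly increasing on $[0,\infty)$, then $\max\{2\psi_y^{-1}(\gamma),2r_y,\psi_y^{-1}(\gamma)+r_y+\|y\|\}$ is an upper bound on the diameter of $L_2(y,\gamma)$. Finally, if $b$ is uniformly convex on $\mathrm{dom}(b)$, then all the first and the second type level-sets of $B$ are bounded. (XVI) Each of the following conditions is sufficient for the boundedness of all the first type level-sets $L_1(x,\gamma)$, $x\in\mathrm{dom}(b)$, $\gamma\in[0,\infty)$: (i) $U$ is bounded; (ii) $U$ is unbounded and $\lim_{\|y\|\to\infty,\,y\in U}B(x,y)=\infty$ for all $x\in\mathrm{dom}(b)$. (XVII) Each of the following conditions is sufficient for the boundedness of all the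 second type level-sets $L_2(y,\gamma)$, $y\in U$, $\gamma\in[0,\infty)$: (i) $U$ is bounded; (ii) $U$ is unbounded and $\lim_{\|x\|\to\infty,\,x\in\mathrm{dom}(b)}B(x,y)=\infty$ for all $y\in U$; (iii) $X$ is finite-dimensional and $b$ is strictly convex on $U$ and is essentially smooth; (iv) $X$ is finite-dimensional and $b$ is strictly convex on $\mathrm{dom}(b)$. (XVIII) Suppose that $b'$ is uniformly continuous on all bounded and convex subsets of $U$. Given two sequences $(x_i)$ and $(y_i)$ in $U$ such that one of them is bounded, suppose that $\lim_{i\to\infty}\|x_i-y_i\|=0$. Then $\lim_{i\to\infty}(B(x,x_i)-B(x,y_i))=0$ for each $x\in\mathrm{dom}(b)$. (XIX) Suppose that $b'$ is weak-to-weak$^*$ sequentially continuous on $U$. If $(y_i)$ is a sequence in $U$ which converges weakly to $y\in U$, then $B(x,y)=\lim_{i\to\infty}(B(x,y_i)-B(y,y_i))$ for all $x\in\mathrm{dom}(b)$. In particular, under the assumptions that $X$ is finite-dimensional and $b'$ is continuous on $U$, if $(y_i)$ is a sequence in $U$ which converges to some $y\in U$ and if $x\in\mathrm{dom}(b)$, then $B(x,y)=\lim_{i\to\infty}(B(x,y_i)-B(y,y_i))$. (XX) Given $x\in\mathrm{dom}(b)$, if $b$ is uniformly convex relative to $(\{x\},S_2\cap U)$ with a relative gauge $\psi_x$ which is continuous and strictly increasing on $[0,\infty)$, and satisfies $\lim_{t\to\infty}\psi_x(t)=\infty$ and $\psi_x(0)=0$, and if $\lim_{i\to\infty}B(x,y_i)=0$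 for some sequence $(y_i)$ in $S_2\cap U$, then $(y_i)$ converges strongly to $x$. Similarly, given $y\in U$, if $b$ is uniformly convex relative to $(S_1,\{y\})$ with a relative gauge $\psi_y$ which is continuous and strictly increasing on $[0,\infty)$, and satisfies $\lim_{t\to\infty}\psi_y(t)=\infty$ and $\psi_y(0)=0$, and if $\lim_{i\to\infty}B(x_i,y)=0$ for some sequence $(x_i)$ in $S_1$, then $(x_i)$ converges strongly to $y$.
   Context: $X^*$ is the dual of $X$ and $\langle x^*,x\rangle:=x^*(x)$. $\mathrm{dom}(b):=\{x\in X:b(x)<\infty\}$, $\mathrm{Int}$ is the interior, and an overline denotes closure. $b$ is Gâteaux differentiable at $x\in\mathrm{Int}(\mathrm{dom}(b))$ if there is $b'(x)\in X^*$ with $\langle b'(x),y\rangle=\lim_{t\to0}(b(x+ty)-b(x))/t$ for all $y\in X$. Boundedness, local boundedness and (uniform) continuity of $b':U\to X^*$ are with respect to the norms. The open interval $(x,y)$ is $\{tx+(1-t)y:0\le t\le 1\}\setminus\{x,y\}$. All sequences are indexed by $i\in\{1,2,\dots\}$. Relative uniform convexity. Let $b:X\to(-\infty,\infty]$ be convex and let $S_1,S_2$ be nonempty subsets (not necessarily convex) of $\mathrm{dom}(b)$. $b$ is uniformly convex relative to $(S_1,S_2)$ if there is $\psi:[0,\infty)\to[0,\infty]$ (called a relative gauge, or gauge) with $\psi(t)>0$ for all $t>0$ such that for all $\lambda\in(0,1)$ and $(x,y)\in S_1\times S_2$: $b(\lambda x+(1-\lambda)y)+\lambda(1-\lambda)\psi(\|x-y\|)\le\lambda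 b(x)+(1-\lambda)b(y)$. If $S_1=S_2=S$, one says that $b$ is uniformly convex on $S$. The optimal gauge (modulus of uniform convexity of $b$ relative to $(S_1,S_2)$) is $$\psi_{b,S_1,S_2}(t):=\inf\Big\{\tfrac{\lambda b(x)+(1-\lambda)b(y)-b(\lambda x+(1-\lambda)y)}{\lambda(1-\lambda)}:(x,y)\in S_1\times S_2,\ \|x-y\|=t,\ \lambda\in(0,1)\Big\},\quad \inf\emptyset:=\infty ,$$ which is defined even if $b$ is not uniformly convex relative to $(S_1,S_2)$. Bregman function. $b:X\to(-\infty,\infty]$ is a Bregman function with zone $U$, and $B$ (defined from $b$ as in the claim) is its Bregman divergence, if: (i) $U=\mathrm{Int}(\mathrm{dom}(b))\ne\emptyset$ and $b$ is Gâteaux differentiable in $U$; (ii) $b$ is convex and lower semicontinuous on $X$ and strictly convex on $\mathrm{dom}(b)$; (iii) for each $\gamma\in\mathbb R$ and $x\in\mathrm{dom}(b)$ the set $\{y\in U:B(x,y)\le\gamma\}$ is bounded; (iv) if $x\in\mathrm{dom}(b)$ and $(y_i)$ in $U$ satisfy $\|x-y_i\|\to0$, then $B(x,y_i)\to0$; (v) if $(x_i)$ is a bounded sequence in $\mathrm{dom}(b)$, $(y_i)$ is a sequence in $U$, $B(x_i,y_i)\to0$ and $\|y_i-y\|\to0$ for some $y\in\mathrm{dom}(b)$, then $\|x_i-y\|\to0$. $b$ is sequentially consistent if for all sequences $(x_i)$ in $\mathrm{dom}(b)$ and $(y_i)$ in $U$ with $(y_i)$ bounded and $B(x_i,y_i)\to0$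 one has $\|x_i-y_i\|\to0$. A map $f:V\to X^*$ ($V\subseteq X$) is weak-to-weak$^*$ sequentially continuous on $V$ if whenever $x_i\in V$ converges weakly to $x\in V$, $\langle f(x_i),z\rangle\to\langle f(x),z\rangle$ for all $z\in X$. For $X$ finite-dimensional, a proper convex $b$ with $U\ne\emptyset$, Gâteaux differentiable in $U$, is essentially smooth if $\|b'(y_i)\|\to\infty$ for each sequence $(y_i)$ in $U$ converging to a boundary point of $\mathrm{dom}(b)$.
   Formalization: (I) inverse form adds: ψ strictly increasing on [0,∞) or ‖x−y‖≤s for some s∈J. (VI) finite-dimensional remark replaced by: the conclusion holds for bounded (x_i) in dom(b). (VII) adds: the compact set lies in dom(b), or Bregman condition (v) also holds for limits in it. *)

theory Defs
  imports "HOL-Analysis.Analysis"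
begin

text \<open>
  Functions with values in the half-open interval from minus infinity (excluded) to plus infinity
  (included) are rendered as \<^typ>\<open>'a \<Rightarrow> ereal\<close>; the exclusion of minus infinity is part of
  \<open>convex_efun\<close>. The dual of \<open>'a\<close> is the type \<open>'a \<Rightarrow>\<^sub>L real\<close> with the operator norm.
\<close>

definition edom :: "('a \<Rightarrow> ereal) \<Rightarrow> 'a set" where
  "edom b = {x. b x < \<infinity>}"

definition convex_efun :: "('a::real_vector \<Rightarrow> ereal) \<Rightarrow> bool" where
  "convex_efun b \<longleftrightarrow> (\<forall>x. b x \<noteq> -\<infinity>) \<and>
     (\<forall>x y. \<forall>l\<in>{0<..<1::real}.
        b (l *\<^sub>R x + (1 - l) *\<^sub>R y) \<le> ereal l * b x + ereal (1 - l) * b y)"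

definition strictly_convex_on :: "'a::real_vector set \<Rightarrow> ('a \<Rightarrow> ereal) \<Rightarrow> bool" where
  "strictly_convex_on S b \<longleftrightarrow>
     (\<forall>x\<in>S. \<forall>y\<in>S. \<forall>l\<in>{0<..<1::real}. x \<noteq> y \<longrightarrow>
        b (l *\<^sub>R x + (1 - l) *\<^sub>R y) < ereal l * b x + ereal (1 - l) * b y)"

definition lsc_efun :: "('a::topological_space \<Rightarrow> ereal) \<Rightarrow> bool" where
  "lsc_efun b \<longleftrightarrow> (\<forall>x. b x \<le> Liminf (nhds x) b)"

definition fin_dim :: "'a::real_vector itself \<Rightarrow> bool" where
  "fin_dim _ \<longleftrightarrow> (\<exists>F::'a set. finite F \<and> span F = UNIV)"


definition has_gateaux_deriv ::
    "('a::real_normed_vector \<Rightarrow> ereal) \<Rightarrow> ('a \<Rightarrow>\<^sub>L real) \<Rightarrow> 'a \<Rightarrow> bool" where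
  "has_gateaux_deriv b f x \<longleftrightarrow> x \<in> interior (edom b) \<and>
     (\<forall>y. ((\<lambda>t. (b (x + t *\<^sub>R y) - b x) / ereal t) \<longlongrightarrow> ereal (blinfun_apply f y)) (at 0))"

definition gateaux_differentiable_on ::
    "('a::real_normed_vector \<Rightarrow> ereal) \<Rightarrow> 'a set \<Rightarrow> bool" where
  "gateaux_differentiable_on b V \<longleftrightarrow> (\<forall>x\<in>V. \<exists>f. has_gateaux_deriv b f x)"

lemma has_gateaux_deriv_unique:
  assumes "has_gateaux_deriv b f x" "has_gateaux_deriv b g x"
  shows "f = g"
proof (rule blinfun_eqI)
  fix y
  have "ereal (blinfun_apply f y) = ereal (blinfun_apply g y)"
    using assms unfolding has_gateaux_deriv_def
    by (metis LIM_unique)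
  then show "blinfun_apply f y = blinfun_apply g y" by simp
qed

definition gateaux_deriv ::
    "('a::real_normed_vector \<Rightarrow> ereal) \<Rightarrow> 'a \<Rightarrow> ('a \<Rightarrow>\<^sub>L real)" where
  "gateaux_deriv b x = (THE f. has_gateaux_deriv b f x)"

lemma gateaux_deriv_eq: "has_gateaux_deriv b f x \<Longrightarrow> gateaux_deriv b x = f"
  unfolding gateaux_deriv_def by (rule the_equality) (auto intro: has_gateaux_deriv_unique)

definition bregman_div :: "('a::real_normed_vector \<Rightarrow> ereal) \<Rightarrow> 'a \<Rightarrow> 'a \<Rightarrow> ereal" where
  "bregman_div b x y =
     (if x \<in> edom b \<and> y \<in> interior (edom b)
      then b x - b y - ereal (blinfun_apply (gateaux_deriv b y) (x - y))
      else \<infinity>)"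

definition level1 :: "('a::real_normed_vector \<Rightarrow> ereal) \<Rightarrow> 'a \<Rightarrow> real \<Rightarrow> 'a set" where
  "level1 b x \<gamma> = {y \<in> interior (edom b). bregman_div b x y \<le> ereal \<gamma>}"

definition level2 :: "('a::real_normed_vector \<Rightarrow> ereal) \<Rightarrow> 'a \<Rightarrow> real \<Rightarrow> 'a set" where
  "level2 b y \<gamma> = {x \<in> edom b. bregman_div b x y \<le> ereal \<gamma>}"


text \<open>A gauge is only meaningful on the nonnegative reals; its values at negative arguments are
  unconstrained and never used.\<close>

definition relative_gauge ::
    "('a::real_normed_vector \<Rightarrow> ereal) \<Rightarrow> 'a set \<Rightarrow> 'a set \<Rightarrow> (real \<Rightarrow> ereal) \<Rightarrow> bool" where
  "relative_gauge b S1 S2 \<psi> \<longleftrightarrow>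
     convex_efun b \<and> S1 \<noteq> {} \<and> S2 \<noteq> {} \<and> S1 \<subseteq> edom b \<and> S2 \<subseteq> edom b \<and>
     (\<forall>t\<ge>0. 0 \<le> \<psi> t) \<and> (\<forall>t>0. 0 < \<psi> t) \<and>
     (\<forall>l\<in>{0<..<1::real}. \<forall>x\<in>S1. \<forall>y\<in>S2.
        b (l *\<^sub>R x + (1 - l) *\<^sub>R y) + ereal (l * (1 - l)) * \<psi> (norm (x - y))
          \<le> ereal l * b x + ereal (1 - l) * b y)"

definition uniformly_convex_rel ::
    "('a::real_normed_vector \<Rightarrow> ereal) \<Rightarrow> 'a set \<Rightarrow> 'a set \<Rightarrow> bool" where
  "uniformly_convex_rel b S1 S2 \<longleftrightarrow> (\<exists>\<psi>. relative_gauge b S1 S2 \<psi>)"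

abbreviation uniformly_convex_on ::
    "('a::real_normed_vector \<Rightarrow> ereal) \<Rightarrow> 'a set \<Rightarrow> bool" where
  "uniformly_convex_on b S \<equiv> uniformly_convex_rel b S S"

definition convexity_modulus ::
    "('a::real_normed_vector \<Rightarrow> ereal) \<Rightarrow> 'a set \<Rightarrow> 'a set \<Rightarrow> real \<Rightarrow> ereal" where
  "convexity_modulus b S1 S2 t =
     Inf {(ereal l * b x + ereal (1 - l) * b y - b (l *\<^sub>R x + (1 - l) *\<^sub>R y)) / ereal (l * (1 - l)) |
            l x y. x \<in> S1 \<and> y \<in> S2 \<and> norm (x - y) = t \<and> l \<in> {0<..<1::real}}"


text \<open>Condition (v) in the definition of a Bregman function, with the set \<open>T\<close> in which the limit
  of the second sequence is allowed to lie as a parameter.\<close>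

definition bregman_limit_property :: "('a::real_normed_vector \<Rightarrow> ereal) \<Rightarrow> 'a set \<Rightarrow> bool" where
  "bregman_limit_property b T \<longleftrightarrow>
     (\<forall>(x::nat \<Rightarrow> 'a) (y::nat \<Rightarrow> 'a). \<forall>z\<in>T.
        (\<forall>i. x i \<in> edom b) \<and> bounded (range x) \<and> (\<forall>i. y i \<in> interior (edom b)) \<and>
        (\<lambda>i. bregman_div b (x i) (y i)) \<longlonglongrightarrow> 0 \<and> (\<lambda>i. norm (y i - z)) \<longlonglongrightarrow> 0 \<longrightarrow>
        (\<lambda>i. norm (x i - z)) \<longlonglongrightarrow> 0)"

definition bregman_function :: "('a::real_normed_vector \<Rightarrow> ereal) \<Rightarrow> 'a set \<Rightarrow> bool" where
  "bregman_function b U \<longleftrightarrow>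
     (U = interior (edom b) \<and> U \<noteq> {} \<and> gateaux_differentiable_on b U) \<and>
     (convex_efun b \<and> lsc_efun b \<and> strictly_convex_on (edom b) b) \<and>
     (\<forall>\<gamma>::real. \<forall>x\<in>edom b. bounded {y \<in> U. bregman_div b x y \<le> ereal \<gamma>}) \<and>
     (\<forall>x\<in>edom b. \<forall>y::nat \<Rightarrow> 'a. (\<forall>i. y i \<in> U) \<and> (\<lambda>i. norm (x - y i)) \<longlonglongrightarrow> 0 \<longrightarrow>
        (\<lambda>i. bregman_div b x (y i)) \<longlonglongrightarrow> 0) \<and>
     bregman_limit_property b (edom b)"

definition sequentially_consistent :: "('a::real_normed_vector \<Rightarrow> ereal) \<Rightarrow> bool" where
  "sequentially_consistent b \<longleftrightarrow>
     (\<forall>(x::nat \<Rightarrow> 'a) (y::nat \<Rightarrow> 'a).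
        (\<forall>i. x i \<in> edom b) \<and> (\<forall>i. y i \<in> interior (edom b)) \<and> bounded (range y) \<and>
        (\<lambda>i. bregman_div b (x i) (y i)) \<longlonglongrightarrow> 0 \<longrightarrow>
        (\<lambda>i. norm (x i - y i)) \<longlonglongrightarrow> 0)"

definition weakly_converges :: "(nat \<Rightarrow> 'a::real_normed_vector) \<Rightarrow> 'a \<Rightarrow> bool" where
  "weakly_converges x l \<longleftrightarrow>
     (\<forall>f::'a \<Rightarrow>\<^sub>L real. (\<lambda>i. blinfun_apply f (x i)) \<longlonglongrightarrow> blinfun_apply f l)"

definition weak_to_weakstar_seq_continuous_on ::
    "'a::real_normed_vector set \<Rightarrow> ('a \<Rightarrow> ('a \<Rightarrow>\<^sub>L real)) \<Rightarrow> bool" where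
  "weak_to_weakstar_seq_continuous_on V f \<longleftrightarrow>
     (\<forall>(x::nat \<Rightarrow> 'a). \<forall>l\<in>V. (\<forall>i. x i \<in> V) \<and> weakly_converges x l \<longrightarrow>
        (\<forall>z. (\<lambda>i. blinfun_apply (f (x i)) z) \<longlonglongrightarrow> blinfun_apply (f l) z))"

definition essentially_smooth :: "('a::real_normed_vector \<Rightarrow> ereal) \<Rightarrow> bool" where
  "essentially_smooth b \<longleftrightarrow>
     fin_dim TYPE('a) \<and> convex_efun b \<and> interior (edom b) \<noteq> {} \<and>
     gateaux_differentiable_on b (interior (edom b)) \<and>
     (\<forall>(y::nat \<Rightarrow> 'a). \<forall>z\<in>frontier (edom b).
        (\<forall>i. y i \<in> interior (edom b)) \<and> y \<longlonglongrightarrow> z \<longrightarrow>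
        filterlim (\<lambda>i. norm (gateaux_deriv b (y i))) at_top sequentially)"

definition bounded_on_bounded_convex ::
    "('a::real_normed_vector \<Rightarrow> 'b::real_normed_vector) \<Rightarrow> 'a set \<Rightarrow> bool" where
  "bounded_on_bounded_convex f U \<longleftrightarrow>
     (\<forall>C\<subseteq>U. bounded C \<and> convex C \<longrightarrow> bounded (f ` C))"

definition uniformly_continuous_on_bounded_convex ::
    "('a::real_normed_vector \<Rightarrow> 'b::real_normed_vector) \<Rightarrow> 'a set \<Rightarrow> bool" where
  "uniformly_continuous_on_bounded_convex f U \<longleftrightarrow>
     (\<forall>C\<subseteq>U. bounded C \<and> convex C \<longrightarrow> uniformly_continuous_on C f)"

definition locally_bounded_at ::
    "('a::real_normed_vector \<Rightarrow> 'b::real_normed_vector) \<Rightarrow> 'a set \<Rightarrow> 'a \<Rightarrow> bool" where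
  "locally_bounded_at f U x \<longleftrightarrow> (\<exists>e>0. bounded (f ` (ball x e \<inter> U)))"

end

theory Submission
  imports Defs
begin

text \<open>
  Write \<open>f\<close> for the finite part of \<open>b\<close>. Convexity bounds the difference quotients of \<open>f\<close> at
  one end of a segment by the slope of the whole segment, so that the Gateaux derivative at an interior
  point is a subgradient there. Most of what follows is deduced from this by moving points along
  segments.

  \<^item> From below. Passing to the limit in the inequality that defines a gauge, with the weight of the
  first point tending to 0, gives \<open>\<psi> (norm (x - y)) \<le> B x y\<close> (lemma \<open>gauge_le_bregman_div\<close>).
  A gauge need not be monotone, so a gauge alone does not exclude that \<open>x\<close> and \<open>y\<close> are far
  apart while \<open>B x y\<close> is small. Two monotonicity properties repair this. Convexity in the first
  argument gives \<open>B (y + t (x - y)) y \<le> t B x y\<close> (lemma \<open>bd_scale\<close>), and monotonicity of the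
  derivative gives \<open>B x z \<le> B x y\<close> for \<open>z\<close> between \<open>x\<close> and \<open>y\<close> (lemma \<open>bd_antimono_segment\<close>).
  Hence either point can be moved towards the other until their distance is a prescribed
  \<open>\<epsilon>\<close>, at which the gauge is evaluated. In this way uniform convexity on convex sets makes points
  with a small divergence close and level sets bounded. Where the gauge is assumed to be increasing
  or to tend to infinity, the first inequality alone is enough.

  \<^item> From above. If the norm of the derivative is at most \<open>M\<close> on the interior points of the segment
  from \<open>x\<close> to \<open>y\<close>, then \<open>B x y \<le> 2 M norm (x - y)\<close>. If \<open>x\<close> lies on the boundary of the domain, it
  is approached along the segment, and lower semicontinuity gives the estimate in the limit
  (lemma \<open>bd_le_grad_bound\<close>). Hence a bound on the derivative makes the divergence of close points
  small and that of bounded sets bounded. A uniformly continuous derivative is bounded on bounded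
  convex sets, and in finite dimension the derivative is locally bounded, because there a convex function is bounded above
  near an interior point.

  \<^item> Strict convexity. The divergence vanishes only on the diagonal (lemma \<open>bd_pos\<close>), and it is lower
  semicontinuous along sequences whose second components converge together with the values and
  the derivatives of \<open>b\<close> (lemma \<open>bd_limit_eq_0\<close>). With compactness of bounded sequences this
  identifies limits. In finite dimension it also bounds \<open>B x y\<close> from below by a positive constant on
  the unit sphere around \<open>y\<close>, and \<open>bd_scale\<close> turns this into linear growth in \<open>x\<close>.

  \<^item> Differences \<open>B z x - B z y\<close> are governed by the three point identity, or are explicit in the
  derivative alone.
\<close>

section \<open>Normed spaces of finite dimension\<close>

text \<open>
  The coordinate of a vector along \<open>a\<close> is controlled by its norm as soon as \<open>a\<close> has positive distance
  from the complementary subspace; this replaces the equivalence of norms in the inductions below.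
\<close>

lemma infdist_scaled_le_norm:
  fixes a :: "'a::real_normed_vector"
  assumes "subspace V" "v \<in> V"
  shows "\<bar>c\<bar> * infdist a V \<le> norm (c *\<^sub>R a + v)"
proof (cases "c = 0")
  case False
  have "- (1 / c) *\<^sub>R v \<in> V"
    using assms by (simp add: subspace_neg subspace_scale)
  then have "infdist a V \<le> dist a (- (1 / c) *\<^sub>R v)"
    by (rule infdist_le)
  then have "\<bar>c\<bar> * infdist a V \<le> \<bar>c\<bar> * norm (a + (1 / c) *\<^sub>R v)"
    by (intro mult_left_mono) (auto simp: dist_norm)
  also have "\<dots> = norm (c *\<^sub>R (a + (1 / c) *\<^sub>R v))"
    by simp
  also have "c *\<^sub>R (a + (1 / c) *\<^sub>R v) = c *\<^sub>R a + v"
    using False by (simp add: scaleR_add_right)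
  finally show ?thesis .
qed simp

lemma closed_if_bounded_subsequences:
  fixes V :: "'a::real_normed_vector set"
  assumes "\<And>x :: nat \<Rightarrow> 'a. \<lbrakk>\<And>i. x i \<in> V; bounded (range x)\<rbrakk> \<Longrightarrow>
             \<exists>l\<in>V. \<exists>r. strict_mono r \<and> (x \<circ> r) \<longlonglongrightarrow> l"
  shows "closed V"
  unfolding closed_sequential_limits
proof (intro allI impI, elim conjE)
  fix x l assume x: "\<forall>n. x n \<in> V" "x \<longlonglongrightarrow> l"
  then have "bounded (range x)"
    by (auto intro: convergent_imp_bounded)
  with assms x obtain l' r where "l' \<in> V" "strict_mono r" "(x \<circ> r) \<longlonglongrightarrow> l'"
    by metis
  with x show "l \<in> V"
    using LIMSEQ_subseq_LIMSEQ LIMSEQ_unique by metis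
qed

text \<open>
  Bolzano-Weierstrass for the span of a finite set, by induction on the set. The span of \<open>F\<close> is closed
  by the induction hypothesis, so a new vector \<open>a\<close> has positive distance from it. The coordinates
  along \<open>a\<close> are therefore bounded, and a convergent subsequence of them leaves a bounded sequence in
  the span of \<open>F\<close>.
\<close>

lemma bounded_subsequence_finite_span:
  fixes x :: "nat \<Rightarrow> 'a::real_normed_vector"
  assumes "finite F" "\<And>i. x i \<in> span F" "bounded (range x)"
  shows "\<exists>l\<in>span F. \<exists>r. strict_mono r \<and> (x \<circ> r) \<longlonglongrightarrow> l"
  using assms
proof (induction F arbitrary: x)
  case empty
  then have "x = (\<lambda>_. 0)" by auto
  then show ?case by (auto intro: strict_mono_id)
next
  case (insert a F)
  show ?case
  proof (cases "a \<in> span F")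
    case True
    then show ?thesis using insert by (simp add: span_redundant)
  next
    case False
    have "closed (span F)"
      using insert.IH by (rule closed_if_bounded_subsequences)
    define d where "d = infdist a (span F)"
    have "d > 0"
      unfolding d_def using False \<open>closed (span F)\<close> span_zero
      by (intro infdist_pos_not_in_closed) auto
    obtain c where c: "\<And>i. x i - c i *\<^sub>R a \<in> span F"
      using insert.prems(1) unfolding span_breakdown_eq by metis
    obtain K where K: "\<And>i. norm (x i) \<le> K"
      using insert.prems(2) by (auto simp: bounded_iff)
    have c_le: "\<bar>c i\<bar> \<le> K / d" for i
    proof -
      have "\<bar>c i\<bar> * d \<le> norm (x i)"
        using infdist_scaled_le_norm[OF subspace_span c[of i], of "c i" a] by (simp add: d_def)
      also have "\<dots> \<le> K" by (rule K)
      finally show ?thesis using \<open>d > 0\<close> by (simp add: field_simps)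
    qed
    then have "bounded (range c)"
      by (auto simp: bounded_iff)
    then obtain r c0 where r: "strict_mono r" "(c \<circ> r) \<longlonglongrightarrow> c0"
      using bounded_imp_convergent_subsequence by metis
    define y where "y = (\<lambda>i. x (r i) - c (r i) *\<^sub>R a)"
    have "norm (y i) \<le> K + K / d * norm a" for i
    proof -
      have "norm (y i) \<le> norm (x (r i)) + \<bar>c (r i)\<bar> * norm a"
        unfolding y_def by (metis norm_triangle_ineq4 norm_scaleR)
      also have "\<dots> \<le> K + K / d * norm a"
        by (intro add_mono mult_right_mono K c_le) auto
      finally show ?thesis .
    qed
    then have "bounded (range y)"
      by (auto simp: bounded_iff)
    moreover have "\<And>i. y i \<in> span F"
      using c by (simp add: y_def)
    ultimately obtain l s where s: "l \<in> span F" "strict_mono s" "(y \<circ> s) \<longlonglongrightarrow> l"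
      using insert.IH by metis
    have "(\<lambda>i. c (r (s i))) \<longlonglongrightarrow> c0"
      using LIMSEQ_subseq_LIMSEQ[OF r(2) s(2)] by (simp add: o_def)
    then have "(\<lambda>i. y (s i) + c (r (s i)) *\<^sub>R a) \<longlonglongrightarrow> l + c0 *\<^sub>R a"
      using s(3) by (intro tendsto_intros) (simp_all add: o_def)
    then have "(x \<circ> (r \<circ> s)) \<longlonglongrightarrow> l + c0 *\<^sub>R a"
      by (simp add: y_def o_def)
    moreover have "strict_mono (r \<circ> s)"
      using r(1) s(2) by (rule strict_mono_o)
    moreover have "l + c0 *\<^sub>R a \<in> span (insert a F)"
      using s(1) unfolding span_breakdown_eq by (intro exI[of _ c0]) simp
    ultimately show ?thesis by blast
  qed
qed

lemma closed_span_finite: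
  fixes F :: "'a::real_normed_vector set"
  assumes "finite F"
  shows "closed (span F)"
  by (rule closed_if_bounded_subsequences) (rule bounded_subsequence_finite_span[OF assms])

lemma fin_dim_bounded_subsequence:
  fixes x :: "nat \<Rightarrow> 'a::real_normed_vector"
  assumes "fin_dim TYPE('a)" "bounded (range x)"
  obtains l r where "strict_mono r" "(x \<circ> r) \<longlonglongrightarrow> l"
proof -
  obtain F :: "'a set" where "finite F" "span F = UNIV"
    using assms(1) unfolding fin_dim_def by blast
  then show thesis
    using bounded_subsequence_finite_span[of F x] assms(2) that by auto
qed

lemma fin_dim_compact:
  fixes K :: "'a::real_normed_vector set"
  assumes "fin_dim TYPE('a)" "bounded K" "closed K"
  shows "compact K"
  unfolding compact_def
proof (intro allI impI)
  fix x :: "nat \<Rightarrow> 'a" assume x: "\<forall>n. x n \<in> K"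
  then have "bounded (range x)"
    using assms(2) by (auto intro: bounded_subset)
  then obtain l r where r: "strict_mono r" "(x \<circ> r) \<longlonglongrightarrow> l"
    using fin_dim_bounded_subsequence[OF assms(1)] by metis
  have "l \<in> K"
    using assms(3) r(2) x unfolding closed_sequential_limits by (metis comp_apply)
  with r show "\<exists>l\<in>K. \<exists>r. strict_mono r \<and> (x \<circ> r) \<longlonglongrightarrow> l"
    by blast
qed

text \<open>
  The induction step splits a small vector into a multiple of the new vector \<open>a\<close> and a small vector
  of the span of \<open>F\<close>, and writes the point as the midpoint of the two displacements doubled. On the
  line through \<open>x\<close> in direction \<open>a\<close> the function is bounded by its values at two end points.
\<close>

lemma convex_on_bounded_above_finite_span:
  fixes f :: "'a::real_normed_vector \<Rightarrow> real"
  assumes "finite F" "convex_on D f" "x \<in> interior D"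
  shows "\<exists>\<delta>>0. \<exists>M. \<forall>v\<in>span F. norm v \<le> \<delta> \<longrightarrow> x + v \<in> D \<and> f (x + v) \<le> M"
  using assms(1)
proof induction
  case empty
  have "x \<in> D" using assms(3) interior_subset by blast
  then show ?case by (intro exI[of _ 1]) auto
next
  case (insert a F)
  have D: "convex D" using assms(2) by (simp add: convex_on_def)
  show ?case
  proof (cases "a \<in> span F")
    case True
    then show ?thesis using insert by (simp add: span_redundant)
  next
    case False
    define d where "d = infdist a (span F)"
    have "d > 0"
      unfolding d_def using False closed_span_finite[OF insert.hyps(1)] span_zero
      by (intro infdist_pos_not_in_closed) auto
    obtain \<delta> M where \<delta>: "\<delta> > 0"
      and M: "\<And>v. \<lbrakk>v \<in> span F; norm v \<le> \<delta>\<rbrakk> \<Longrightarrow> x + v \<in> D \<and> f (x + v) \<le> M"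
      using insert.IH by blast
    obtain \<eta> where \<eta>: "\<eta> > 0" "cball x \<eta> \<subseteq> D"
      using assms(3) by (auto simp: mem_interior_cball)
    \<comment> \<open>The points at parameter \<open>\<tau>\<close> and \<open>-\<tau>\<close> stay in the ball of radius \<open>\<eta>\<close>; adding 1 avoids a division by zero.\<close>
    define \<tau> where "\<tau> = \<eta> / (norm a + 1)"
    have "\<tau> > 0" using \<eta> by (auto simp: \<tau>_def add_nonneg_pos intro!: divide_pos_pos)
    have "\<tau> * norm a \<le> \<tau> * (norm a + 1)"
      using \<open>\<tau> > 0\<close> by simp
    also have "\<dots> = \<eta>"
      using norm_ge_zero[of a] by (simp add: \<tau>_def add_nonneg_eq_0_iff)
    finally have ends: "x + \<tau> *\<^sub>R a \<in> D" "x - \<tau> *\<^sub>R a \<in> D"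
      using \<eta>(2) \<open>\<tau> > 0\<close> by (auto simp: subset_iff dist_norm)
    define M' where "M' = max (f (x + \<tau> *\<^sub>R a)) (f (x - \<tau> *\<^sub>R a))"
    have line: "x + s *\<^sub>R a \<in> D \<and> f (x + s *\<^sub>R a) \<le> M'" if "\<bar>s\<bar> \<le> \<tau>" for s
    proof -
      define u where "u = (\<tau> + s) / (2 * \<tau>)"
      have u: "0 \<le> u" "u \<le> 1" using that \<open>\<tau> > 0\<close> by (auto simp: u_def field_simps)
      have "u * \<tau> + (u - 1) * \<tau> = s"
        using \<open>\<tau> > 0\<close> by (simp add: u_def field_simps)
      then have comb: "u *\<^sub>R (x + \<tau> *\<^sub>R a) + (1 - u) *\<^sub>R (x - \<tau> *\<^sub>R a) = x + s *\<^sub>R a"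
        by (auto simp: algebra_simps simp flip: scaleR_add_left)
      have "x + s *\<^sub>R a \<in> D"
        using convexD[OF D ends, of u "1 - u"] u comb by simp
      moreover have "f (x + s *\<^sub>R a) \<le> u * f (x + \<tau> *\<^sub>R a) + (1 - u) * f (x - \<tau> *\<^sub>R a)"
        using assms(2) ends u comb unfolding convex_on_def by (metis add.commute diff_add_cancel diff_ge_0_iff_ge)
      moreover have "\<dots> \<le> u * M' + (1 - u) * M'"
        using u by (intro add_mono mult_left_mono) (auto simp: M'_def)
      ultimately show ?thesis by (simp add: algebra_simps)
    qed
    \<comment> \<open>The first bound keeps \<open>2 w\<close> within \<open>\<delta>\<close>, the second one \<open>2 c\<close> within \<open>\<tau>\<close>.\<close>
    define \<delta>' where "\<delta>' = min (\<delta> / (2 * (1 + norm a / d))) (\<tau> * d / 2)"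
    have "1 + norm a / d > 0" using \<open>d > 0\<close> by (simp add: add_pos_nonneg)
    then have "\<delta>' > 0" using \<delta> \<open>d > 0\<close> \<open>\<tau> > 0\<close> by (simp add: \<delta>'_def)
    moreover have "x + v \<in> D \<and> f (x + v) \<le> (M' + M) / 2"
      if v: "v \<in> span (insert a F)" "norm v \<le> \<delta>'" for v
    proof -
      obtain c where c: "v - c *\<^sub>R a \<in> span F"
        using v(1) unfolding span_breakdown_eq by blast
      define w where "w = v - c *\<^sub>R a"
      have cd: "\<bar>c\<bar> * d \<le> norm v"
        using infdist_scaled_le_norm[OF subspace_span c, of c a] by (simp add: d_def)
      also have "\<dots> \<le> \<tau> * d / 2" using v(2) by (simp add: \<delta>'_def)
      finally have "\<bar>2 * c\<bar> \<le> \<tau>" using \<open>d > 0\<close> by simp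
      then have A: "x + (2 * c) *\<^sub>R a \<in> D" "f (x + (2 * c) *\<^sub>R a) \<le> M'"
        using line by auto
      have "norm w \<le> norm v + \<bar>c\<bar> * norm a"
        unfolding w_def by (metis norm_triangle_ineq4 norm_scaleR)
      also have "\<dots> \<le> norm v + norm v / d * norm a"
        using cd \<open>d > 0\<close> by (intro add_left_mono mult_right_mono) (auto simp: field_simps)
      also have "\<dots> = norm v * (1 + norm a / d)"
        by (simp add: algebra_simps)
      also have "\<dots> \<le> \<delta> / (2 * (1 + norm a / d)) * (1 + norm a / d)"
        using v(2) \<open>1 + norm a / d > 0\<close> by (intro mult_right_mono) (auto simp: \<delta>'_def)
      also have "\<dots> = \<delta> / 2"
      proof -
        have "\<delta> / (2 * q) * q = \<delta> / 2" if "q > 0" for q using that by simp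
        then show ?thesis using \<open>1 + norm a / d > 0\<close> by blast
      qed
      finally have "norm (2 *\<^sub>R w) \<le> \<delta>" by simp
      moreover have "2 *\<^sub>R w \<in> span F"
        using c by (simp add: w_def span_scale)
      ultimately have B: "x + 2 *\<^sub>R w \<in> D" "f (x + 2 *\<^sub>R w) \<le> M"
        using M by auto
      have "(1/2) *\<^sub>R x + (1/2) *\<^sub>R x = x"
        by (simp flip: scaleR_add_left)
      then have comb: "(1/2) *\<^sub>R (x + (2 * c) *\<^sub>R a) + (1/2) *\<^sub>R (x + 2 *\<^sub>R w) = x + v"
        by (simp add: w_def scaleR_add_right)
      have "x + v \<in> D"
        using convexD[OF D A(1) B(1), of "1/2" "1/2"] comb by simp
      moreover have "f (x + v) \<le> 1/2 * f (x + (2 * c) *\<^sub>R a) + 1/2 * f (x + 2 *\<^sub>R w)"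
        using assms(2) A(1) B(1) comb unfolding convex_on_def
        by (metis field_sum_of_halves half_bounded_equal zero_le_divide_1_iff zero_le_numeral)
      ultimately show ?thesis using A(2) B(2) by auto
    qed
    ultimately show ?thesis by blast
  qed
qed

section \<open>Limits and bounded sets\<close>

lemma LIMSEQ_if_subsequences:
  assumes "\<And>r :: nat \<Rightarrow> nat. strict_mono r \<Longrightarrow> \<exists>s. strict_mono s \<and> (\<lambda>i. x (r (s i))) \<longlonglongrightarrow> l"
  shows "x \<longlonglongrightarrow> l"
proof (rule topological_tendstoI, rule ccontr)
  fix W assume W: "open W" "l \<in> W" "\<not> eventually (\<lambda>i. x i \<in> W) sequentially"
  then obtain r :: "nat \<Rightarrow> nat" where r: "strict_mono r" "\<And>i. x (r i) \<notin> W"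
    using not_eventually_sequentiallyD by blast
  then obtain s where "(\<lambda>i. x (r (s i))) \<longlonglongrightarrow> l"
    using assms by blast
  then have "eventually (\<lambda>i. x (r (s i)) \<in> W) sequentially"
    using W by (simp add: topological_tendstoD)
  then show False using r(2) by simp
qed

text \<open>
  The form in which lower bounds for the divergence are used: distances tend to 0 because
  distances of at least \<open>\<epsilon>\<close> force the divergence above a positive constant.
\<close>

lemma tendsto_0_if_minorized:
  fixes a :: "nat \<Rightarrow> real" and e :: "nat \<Rightarrow> ereal"
  assumes "e \<longlonglongrightarrow> 0" "\<And>i. 0 \<le> a i"
    and "\<And>\<epsilon>. 0 < \<epsilon> \<Longrightarrow> \<exists>c>0. \<forall>i. \<epsilon> \<le> a i \<longrightarrow> c \<le> e i"
  shows "a \<longlonglongrightarrow> 0"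
proof (rule tendstoI)
  fix \<epsilon> :: real assume "0 < \<epsilon>"
  then obtain c where c: "c > 0" "\<And>i. \<epsilon> \<le> a i \<Longrightarrow> c \<le> e i" using assms(3) by blast
  have "eventually (\<lambda>i. e i < c) sequentially"
    using assms(1) c(1) by (rule order_tendstoD)
  then show "eventually (\<lambda>i. dist (a i) 0 < \<epsilon>) sequentially"
  proof eventually_elim
    case (elim i)
    then have "a i < \<epsilon>" using c(2)[of i] by (meson not_le)
    then show ?case using assms(2)[of i] by simp
  qed
qed

lemma bounded_range_if_dist_tendsto_0:
  fixes x y :: "nat \<Rightarrow> 'a::real_normed_vector"
  assumes "(\<lambda>i. norm (x i - y i)) \<longlonglongrightarrow> 0" "bounded (range x) \<or> bounded (range y)"
  shows "bounded (range x)" "bounded (range y)"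
proof -
  have "(\<lambda>i. x i - y i) \<longlonglongrightarrow> 0"
    using assms(1) by (simp add: tendsto_norm_zero_iff)
  then have d: "bounded (range (\<lambda>i. x i - y i))"
    by (rule convergent_imp_bounded)
  have "bounded (range (\<lambda>i. (x i - y i) + y i))" if "bounded (range y)"
    using d that by (rule bounded_plus_comp)
  moreover have "bounded (range (\<lambda>i. x i - (x i - y i)))" if "bounded (range x)"
    using that d by (rule bounded_minus_comp)
  ultimately show "bounded (range x)" "bounded (range y)"
    using assms(2) by auto
qed

lemma SUP_less_infty_obtain:
  fixes g :: "'b \<Rightarrow> ereal"
  assumes "(SUP y\<in>S. g y) < \<infinity>"
  obtains K :: real where "\<And>y. y \<in> S \<Longrightarrow> g y \<le> ereal K"
proof -
  obtain n :: nat where "(SUP y\<in>S. g y) < ereal (real n)"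
    using assms less_PInf_Ex_of_nat by auto
  then show thesis
    using that[of "real n"] by (meson SUP_upper less_imp_le order_trans)
qed

lemma bounded_if_SUP_norm:
  assumes "(SUP y\<in>S. ereal (norm (x - y))) < \<infinity>"
  shows "bounded S"
proof -
  obtain K where "\<And>y. y \<in> S \<Longrightarrow> ereal (norm (x - y)) \<le> ereal K"
    using SUP_less_infty_obtain[OF assms] by blast
  then show ?thesis
    unfolding bounded_def by (intro exI[of _ x] exI[of _ K]) (auto simp: dist_norm)
qed

lemma bounded_sublevel_if_coercive:
  fixes g :: "'a::real_normed_vector \<Rightarrow> ereal"
  assumes "(g \<longlongrightarrow> \<infinity>) (inf at_infinity (principal A))"
  shows "bounded {y \<in> A. g y \<le> ereal \<gamma>}"
proof -
  have "eventually (\<lambda>y. ereal \<gamma> < g y) (inf at_infinity (principal A))"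
    using assms by (simp add: tendsto_PInfty)
  then obtain R where "\<And>y. R \<le> norm y \<Longrightarrow> y \<in> A \<Longrightarrow> ereal \<gamma> < g y"
    unfolding eventually_inf_principal eventually_at_infinity by blast
  then show ?thesis
    unfolding bounded_iff by (metis (mono_tags, lifting) linear mem_Collect_eq not_le)
qed

text \<open>
  A segment in a bounded convex set is cut into a number of pieces, depending only on the diameter,
  that are so short that the function changes by less than 1 over each of them.
\<close>

lemma uniformly_continuous_on_bounded_convex_imp_bounded:
  fixes g :: "'a::real_normed_vector \<Rightarrow> 'b::real_normed_vector"
  assumes "uniformly_continuous_on_bounded_convex g V"
  shows "bounded_on_bounded_convex g V"
  unfolding bounded_on_bounded_convex_def
proof (intro allI impI, elim conjE)
  fix C assume C: "C \<subseteq> V" "bounded C" "convex C"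
  have "uniformly_continuous_on C g"
    using assms C unfolding uniformly_continuous_on_bounded_convex_def by blast
  then obtain d where d: "d > 0" "\<And>u v. \<lbrakk>u \<in> C; v \<in> C; dist v u < d\<rbrakk> \<Longrightarrow> dist (g v) (g u) < 1"
    unfolding uniformly_continuous_on_def using zero_less_one by metis
  obtain K where K: "\<And>u v. \<lbrakk>u \<in> C; v \<in> C\<rbrakk> \<Longrightarrow> dist u v \<le> K"
    using C(2) unfolding bounded_two_points by blast
  obtain n :: nat where n: "K / d < real n" using reals_Archimedean2 by blast
  have "dist (g u) (g v) \<le> real n" if uv: "u \<in> C" "v \<in> C" for u v
  proof -
    have "0 \<le> K" using K[OF uv] zero_le_dist order_trans by blast
    then have "n > 0" using n d(1) by (cases n) (auto simp: not_less divide_less_0_iff)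
    define p where "p = (\<lambda>k. u + (real k / real n) *\<^sub>R (v - u))"
    have p_in: "p k \<in> C" if "k \<le> n" for k
    proof -
      have "p k = (1 - real k / real n) *\<^sub>R u + (real k / real n) *\<^sub>R v"
        by (simp add: p_def algebra_simps)
      then show ?thesis
        using that \<open>n > 0\<close> uv by (auto intro!: convexD[OF C(3)])
    qed
    have step: "dist (p (Suc k)) (p k) < d" for k
    proof -
      have "p (Suc k) - p k = (1 / real n) *\<^sub>R (v - u)"
        by (simp add: p_def add_divide_distrib scaleR_add_left)
      then have "dist (p (Suc k)) (p k) = dist v u / real n"
        by (simp add: dist_norm)
      also have "\<dots> \<le> K / real n"
        using K[OF uv(2,1)] by (intro divide_right_mono) auto
      also have "\<dots> < d" using n d(1) \<open>n > 0\<close> by (simp add: field_simps)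
      finally show ?thesis .
    qed
    have "dist (g (p k)) (g (p 0)) \<le> real k" if "k \<le> n" for k
      using that
    proof (induction k)
      case (Suc k)
      have "dist (g (p (Suc k))) (g (p 0)) \<le> dist (g (p (Suc k))) (g (p k)) + dist (g (p k)) (g (p 0))"
        by (rule dist_triangle)
      also have "\<dots> \<le> 1 + real k"
        using Suc d(2)[OF p_in p_in step] by (intro add_mono) (auto intro: less_imp_le)
      finally show ?case by simp
    qed simp
    from this[of n] show ?thesis using \<open>n > 0\<close> by (simp add: p_def dist_commute)
  qed
  then show "bounded (g ` C)"
    unfolding bounded_two_points by blast
qed

text \<open>
  The three terms of the maximum are the cases of two far points, of two near points, and of one of
  each, where near means of norm less than \<open>r\<close>.
\<close>

lemma diameter_le_of_far_points:
  fixes x :: "'a::real_normed_vector"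
  assumes "0 \<le> r" "\<And>y. y \<in> S \<Longrightarrow> r \<le> norm y \<Longrightarrow> norm (x - y) \<le> s"
  shows "diameter S \<le> Max {2 * s, 2 * r, s + r + norm x}"
proof -
  let ?m = "Max {2 * s, 2 * r, s + r + norm x}"
  have m: "2 * s \<le> ?m" "2 * r \<le> ?m" "s + r + norm x \<le> ?m" by auto
  have mixed: "norm (u - v) \<le> ?m" if "u \<in> S" "r \<le> norm u" "norm v < r" for u v
  proof -
    have "norm (u - v) \<le> norm (x - u) + norm x + norm v"
      using norm_triangle_ineq4[of "x - v" "x - u"] norm_triangle_ineq4[of x v] by simp
    then show ?thesis using assms(2)[OF that(1,2)] that(3) m(3) by linarith
  qed
  have "norm (u - v) \<le> ?m" if uv: "u \<in> S" "v \<in> S" for u v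
  proof (cases "r \<le> norm u"; cases "r \<le> norm v")
    assume "r \<le> norm u" "r \<le> norm v"
    then show ?thesis
      using assms(2)[OF uv(1)] assms(2)[OF uv(2)] norm_triangle_ineq4[of "x - v" "x - u"] m(1) by simp
  next
    assume "r \<le> norm u" "\<not> r \<le> norm v"
    then show ?thesis using mixed[of u v] uv by simp
  next
    assume "\<not> r \<le> norm u" "r \<le> norm v"
    then show ?thesis using mixed[of v u] uv by (simp add: norm_minus_commute)
  next
    assume "\<not> r \<le> norm u" "\<not> r \<le> norm v"
    then show ?thesis using norm_triangle_ineq4[of u v] m(2) by linarith
  qed
  then show ?thesis
    using assms(1) m(2) by (intro diameter_le) auto
qed

lemma lsc_efun_le_limit:
  fixes b :: "'a::topological_space \<Rightarrow> ereal"
  assumes "lsc_efun b" "x \<longlonglongrightarrow> l" "c \<longlonglongrightarrow> m" "eventually (\<lambda>i. b (x i) \<le> ereal (c i)) sequentially"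
  shows "b l \<le> ereal m"
proof (rule ccontr)
  assume "\<not> b l \<le> ereal m"
  then obtain k where k: "ereal m < ereal k" "ereal k < b l"
    using ereal_dense2[of "ereal m" "b l"] by (auto simp: not_le)
  have "eventually (\<lambda>y. ereal k < b y) (nhds l)"
    using assms(1) k(2) unfolding lsc_efun_def le_Liminf_iff by blast
  then have "eventually (\<lambda>i. ereal k < b (x i)) sequentially"
    using assms(2) by (rule eventually_compose_filterlim)
  with assms(4) have "eventually (\<lambda>i. k \<le> c i) sequentially"
    by eventually_elim (use order_less_le_trans in fastforce)
  then have "k \<le> m"
    using assms(3) by (intro tendsto_lowerbound) auto
  with k(1) show False by simp
qed

section \<open>Convex functions with a Gateaux derivative\<close>

locale gateaux_convex =
  fixes b :: "'a::real_normed_vector \<Rightarrow> ereal"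
  assumes convex: "convex_efun b"
    and gateaux: "gateaux_differentiable_on b (interior (edom b))"
begin

abbreviation D :: "'a set" where "D \<equiv> edom b"
abbreviation U :: "'a set" where "U \<equiv> interior (edom b)"
abbreviation grad :: "'a \<Rightarrow> ('a \<Rightarrow>\<^sub>L real)" where "grad \<equiv> gateaux_deriv b"

text \<open>
  Real-valued counterparts of \<open>b\<close> and of its divergence, which agree with them on \<open>D\<close> and on
  \<open>D \<times> U\<close> respectively. The values elsewhere are meaningless.
\<close>

definition f :: "'a \<Rightarrow> real" where "f x = real_of_ereal (b x)"

definition bd :: "'a \<Rightarrow> 'a \<Rightarrow> real" where
  "bd x y = f x - f y - blinfun_apply (grad y) (x - y)"

lemma U_subset: "x \<in> U \<Longrightarrow> x \<in> D"
  using interior_subset by blast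

lemma b_eq: "x \<in> D \<Longrightarrow> b x = ereal (f x)"
  using convex by (cases "b x") (auto simp: convex_efun_def edom_def f_def)

lemma in_domI: "b x \<le> ereal c \<Longrightarrow> x \<in> D"
  unfolding edom_def using le_less_trans[of "b x" "ereal c" \<infinity>] by simp

lemma bregman_div_eq: "x \<in> D \<Longrightarrow> y \<in> U \<Longrightarrow> bregman_div b x y = ereal (bd x y)"
  by (simp add: bregman_div_def bd_def b_eq U_subset)

lemma convex_comb:
  assumes "x \<in> D" "y \<in> D" "0 < l" "l < 1"
  shows "l *\<^sub>R x + (1 - l) *\<^sub>R y \<in> D"
    and "f (l *\<^sub>R x + (1 - l) *\<^sub>R y) \<le> l * f x + (1 - l) * f y"
proof -
  have "b (l *\<^sub>R x + (1 - l) *\<^sub>R y) \<le> ereal l * b x + ereal (1 - l) * b y"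
    using convex assms(3,4) unfolding convex_efun_def by auto
  then have *: "b (l *\<^sub>R x + (1 - l) *\<^sub>R y) \<le> ereal (l * f x + (1 - l) * f y)"
    using assms(1,2) by (simp add: b_eq)
  then show "l *\<^sub>R x + (1 - l) *\<^sub>R y \<in> D" by (rule in_domI)
  with * show "f (l *\<^sub>R x + (1 - l) *\<^sub>R y) \<le> l * f x + (1 - l) * f y"
    by (simp add: b_eq)
qed

lemma convex_dom: "convex D"
proof (rule convexI)
  fix x y :: 'a and u v :: real
  assume *: "x \<in> D" "y \<in> D" "0 \<le> u" "0 \<le> v" "u + v = 1"
  then have v: "v = 1 - u" by simp
  show "u *\<^sub>R x + v *\<^sub>R y \<in> D"
    unfolding v using * convex_comb(1)[of x y u] by (cases "u = 0 \<or> u = 1") auto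
qed

lemma convex_on_f: "convex_on D f"
proof (rule convex_onI[OF _ convex_dom])
  show "f ((1 - t) *\<^sub>R x + t *\<^sub>R y) \<le> (1 - t) * f x + t * f y"
    if "0 < t" "t < 1" "x \<in> D" "y \<in> D" for t x y
    using convex_comb(2)[of x y "1 - t"] that by simp
qed

lemma segment_in_dom:
  assumes "x \<in> D" "y \<in> D" "0 \<le> t" "t \<le> 1"
  shows "y + t *\<^sub>R (x - y) \<in> D"
  using convexD[OF convex_dom assms(1,2), of t "1 - t"] assms by (simp add: algebra_simps)

text \<open>
  Shrinking the interior towards \<open>x\<close> gives an open subset of the domain.
\<close>

lemma segment_in_interior:
  assumes "x \<in> D" "y \<in> U" "0 < t" "t \<le> 1"
  shows "x + t *\<^sub>R (y - x) \<in> U"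
proof -
  let ?W = "(+) ((1 - t) *\<^sub>R x) ` (*\<^sub>R) t ` U"
  have "?W \<subseteq> D"
    using convex_dom assms(1,3,4) U_subset by (auto intro!: convexD)
  moreover have "open ?W"
    using assms(3) by (intro open_translation open_scaling) auto
  moreover have "x + t *\<^sub>R (y - x) = (1 - t) *\<^sub>R x + t *\<^sub>R y"
    by (simp add: algebra_simps)
  ultimately show ?thesis
    using assms(2) interior_maximal by blast
qed

lemma dom_subset_closure_U:
  assumes "U \<noteq> {}"
  shows "D \<subseteq> closure U"
proof
  fix x assume x: "x \<in> D"
  obtain u where u: "u \<in> U" using assms by blast
  have "(\<lambda>n. x + (1 / real (Suc n)) *\<^sub>R (u - x)) \<longlonglongrightarrow> x + 0 *\<^sub>R (u - x)"
    using LIMSEQ_inverse_real_of_nat by (intro tendsto_intros) (simp add: inverse_eq_divide)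
  moreover have "x + (1 / real (Suc n)) *\<^sub>R (u - x) \<in> U" for n
    using x u by (intro segment_in_interior) auto
  ultimately show "x \<in> closure U"
    unfolding closure_sequential by fastforce
qed

lemma has_grad: "y \<in> U \<Longrightarrow> has_gateaux_deriv b (grad y) y"
  using gateaux gateaux_deriv_eq unfolding gateaux_differentiable_on_def by metis

lemma difference_quotient_tendsto:
  assumes "x \<in> D" "y \<in> U"
  shows "((\<lambda>t. (f (y + t *\<^sub>R (x - y)) - f y) / t) \<longlongrightarrow> blinfun_apply (grad y) (x - y)) (at_right 0)"
proof -
  have "((\<lambda>t. (b (y + t *\<^sub>R (x - y)) - b y) / ereal t) \<longlongrightarrow> ereal (blinfun_apply (grad y) (x - y))) (at_right 0)"
    using has_grad[OF assms(2)] unfolding has_gateaux_deriv_def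
    by (auto intro: filterlim_mono simp: at_le)
  moreover have "eventually (\<lambda>t. (b (y + t *\<^sub>R (x - y)) - b y) / ereal t
       = ereal ((f (y + t *\<^sub>R (x - y)) - f y) / t)) (at_right 0)"
    using eventually_at_right_real[of 0 1, OF zero_less_one]
  proof eventually_elim
    case (elim t)
    then have "y + t *\<^sub>R (x - y) \<in> D"
      using assms U_subset by (intro segment_in_dom) auto
    then show ?case using elim assms by (simp add: b_eq U_subset)
  qed
  ultimately have "((\<lambda>t. ereal ((f (y + t *\<^sub>R (x - y)) - f y) / t)) \<longlongrightarrow> ereal (blinfun_apply (grad y) (x - y))) (at_right 0)"
    by (rule Lim_transform_eventually)
  then show ?thesis by simp
qed

text \<open>
  Dividing the hypothesis by \<open>t\<close> bounds the difference quotient of \<open>f\<close> at \<open>y\<close> by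
  \<open>f x - f y - (1 - t) * c\<close>; now \<open>t\<close> tends to 0. For \<open>c = 0\<close> this is the subgradient inequality, for
  other \<open>c\<close> the bound by a gauge.
\<close>

lemma le_bd:
  assumes "x \<in> D" "y \<in> U"
    and "\<And>t. \<lbrakk>0 < t; t < 1\<rbrakk> \<Longrightarrow>
           f (t *\<^sub>R x + (1 - t) *\<^sub>R y) + t * (1 - t) * c \<le> t * f x + (1 - t) * f y"
  shows "c \<le> bd x y"
proof -
  have "((\<lambda>t. f x - f y - (1 - t) * c) \<longlongrightarrow> f x - f y - (1 - 0) * c) (at_right 0)"
    by (intro tendsto_intros)
  moreover have "eventually (\<lambda>t. (f (y + t *\<^sub>R (x - y)) - f y) / t \<le> f x - f y - (1 - t) * c) (at_right 0)"
    using eventually_at_right_real[of 0 1, OF zero_less_one]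
  proof eventually_elim
    case (elim t)
    have "y + t *\<^sub>R (x - y) = t *\<^sub>R x + (1 - t) *\<^sub>R y"
      by (simp add: algebra_simps)
    then have "f (y + t *\<^sub>R (x - y)) + t * (1 - t) * c \<le> t * f x + (1 - t) * f y"
      using assms(3)[of t] elim by simp
    then have "f (y + t *\<^sub>R (x - y)) - f y \<le> (f x - f y - (1 - t) * c) * t"
      by argo
    then show ?case
      using elim by (simp add: pos_divide_le_eq)
  qed
  ultimately have "blinfun_apply (grad y) (x - y) \<le> f x - f y - (1 - 0) * c"
    using difference_quotient_tendsto[OF assms(1,2)] by (intro tendsto_le[OF trivial_limit_at_right_real])
  then show ?thesis by (simp add: bd_def)
qed

lemma bd_nonneg: "x \<in> D \<Longrightarrow> y \<in> U \<Longrightarrow> 0 \<le> bd x y"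
  using convex_comb(2) U_subset by (intro le_bd) auto

lemma bd_self [simp]: "bd y y = 0"
  by (simp add: bd_def blinfun.zero_right)

lemma bregman_div_nonneg: "0 \<le> bregman_div b x y"
  using bd_nonneg bregman_div_eq by (cases "x \<in> D \<and> y \<in> U") (auto simp: bregman_div_def)

lemma bd_scale:
  assumes "x \<in> D" "y \<in> U" "0 \<le> t" "t \<le> 1"
  shows "bd (y + t *\<^sub>R (x - y)) y \<le> t * bd x y"
proof -
  have "f (t *\<^sub>R x + (1 - t) *\<^sub>R y) \<le> t * f x + (1 - t) * f y"
    using convex_on_f assms U_subset unfolding convex_on_def by auto
  moreover have "t *\<^sub>R x + (1 - t) *\<^sub>R y = y + t *\<^sub>R (x - y)"
    by (simp add: algebra_simps)
  ultimately have "f (y + t *\<^sub>R (x - y)) \<le> t * f x + (1 - t) * f y"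
    by simp
  then show ?thesis
    by (simp add: bd_def blinfun.scaleR_right right_diff_distrib left_diff_distrib)
qed

lemma three_point_identity:
  "bd z x - bd z y = bd y x + blinfun_apply (grad y - grad x) (z - y)"
  by (simp add: bd_def blinfun.diff_left blinfun.diff_right algebra_simps)

text \<open>
  With \<open>z = y + t (x - y)\<close> and \<open>h = x - y\<close>, the subgradient inequalities between \<open>y\<close> and \<open>z\<close> say that
  \<open>f z - f y\<close> lies between \<open>t * grad y h\<close> and \<open>t * grad z h\<close>. The first bound and the resulting
  monotonicity of the derivative make both summands of the difference nonnegative.
\<close>

lemma bd_antimono_segment:
  assumes "x \<in> D" "y \<in> U" "0 \<le> t" "t < 1"
  shows "bd x (y + t *\<^sub>R (x - y)) \<le> bd x y"
proof (cases "t = 0")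
  case False
  define z where "z = y + t *\<^sub>R (x - y)"
  define h where "h = x - y"
  have "z = x + (1 - t) *\<^sub>R (y - x)" by (simp add: z_def algebra_simps)
  then have z: "z \<in> U" using segment_in_interior[of x y "1 - t"] assms by simp
  have diffs: "z - y = t *\<^sub>R h" "x - z = (1 - t) *\<^sub>R h" "y - z = - t *\<^sub>R h"
    by (simp_all add: z_def h_def algebra_simps)
  have 1: "t * grad y h \<le> f z - f y"
    using bd_nonneg[of z y] z assms U_subset by (simp add: bd_def diffs blinfun.scaleR_right)
  have 2: "f z - f y \<le> t * grad z h"
    using bd_nonneg[of y z] z assms U_subset by (simp add: bd_def diffs blinfun.scaleR_right blinfun.minus_right)
  have "grad y h \<le> grad z h"
    using order_trans[OF 1 2] False assms(3) by (simp add: mult_le_cancel_left)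
  then have "0 \<le> (1 - t) * (grad z h - grad y h)"
    using assms(4) by simp
  moreover have "bd x y - bd x z = (f z - f y - t * grad y h) + (1 - t) * (grad z h - grad y h)"
    unfolding bd_def diffs h_def[symmetric] blinfun.scaleR_right real_scaleR_def by argo
  ultimately have "0 \<le> bd x y - bd x z" using 1 by linarith
  then show ?thesis by (simp add: z_def)
qed simp

text \<open>
  The subgradient inequality at a point \<open>u\<close> of the segment bounds \<open>f u - f y\<close> by \<open>M * norm (x - y)\<close>.
  Letting \<open>u\<close> tend to \<open>x\<close>, lower semicontinuity carries this to \<open>x\<close>, where no derivative need
  exist.
\<close>

lemma bd_le_grad_bound:
  assumes "lsc_efun b" "x \<in> D" "y \<in> U"
    and M: "\<And>u. \<lbrakk>u \<in> U; u \<in> closed_segment x y\<rbrakk> \<Longrightarrow> norm (grad u) \<le> M"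
  shows "bd x y \<le> 2 * M * norm (x - y)"
proof -
  define z where "z = (\<lambda>n. x + (1 / real (Suc n)) *\<^sub>R (y - x))"
  have bound: "f u - f y \<le> M * norm (x - y)" if "u = z n" for u n
  proof -
    have u: "u \<in> U"
      unfolding that z_def using assms by (intro segment_in_interior) auto
    have "u \<in> closed_segment x y"
      unfolding that z_def in_segment by (intro exI[of _ "1 / real (Suc n)"]) (auto simp: algebra_simps)
    note norm_u = M[OF u this]
    have "f u - f y \<le> grad u (u - y)"
      using bd_nonneg[of y u] u assms U_subset
      by (simp add: bd_def blinfun.diff_right)
    also have "\<dots> \<le> norm (grad u) * norm (u - y)"
      using norm_blinfun[of "grad u" "u - y"] by simp
    also have "u - y = (1 - 1 / real (Suc n)) *\<^sub>R (x - y)"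
      by (simp add: that z_def algebra_simps)
    also have "norm \<dots> \<le> norm (x - y)"
      by (simp add: abs_if mult_left_le_one_le)
    finally have "f u - f y \<le> norm (grad u) * norm (x - y)"
      by (simp add: mult_left_mono)
    also have "\<dots> \<le> M * norm (x - y)"
      using norm_u by (simp add: mult_right_mono)
    finally show ?thesis .
  qed
  have "z \<longlonglongrightarrow> x + 0 *\<^sub>R (y - x)"
    unfolding z_def using LIMSEQ_inverse_real_of_nat
    by (intro tendsto_intros) (simp add: inverse_eq_divide)
  then have lim: "z \<longlonglongrightarrow> x" by simp
  have "b (z n) \<le> ereal (f y + M * norm (x - y))" for n
  proof -
    have "z n \<in> D"
      unfolding z_def using segment_in_dom[of y x] assms(2,3) U_subset by simp
    then show ?thesis using bound[of "z n" n] by (simp add: b_eq)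
  qed
  then have "b x \<le> ereal (f y + M * norm (x - y))"
    by (intro lsc_efun_le_limit[OF assms(1) lim tendsto_const]) simp
  then have 1: "f x - f y \<le> M * norm (x - y)"
    using assms(2) by (simp add: b_eq)
  have "norm (grad y) \<le> M"
    using assms(3) by (intro M) auto
  have "\<bar>grad y (x - y)\<bar> \<le> norm (grad y) * norm (x - y)"
    using norm_blinfun[of "grad y" "x - y"] by simp
  also have "\<dots> \<le> M * norm (x - y)"
    using \<open>norm (grad y) \<le> M\<close> by (intro mult_right_mono) auto
  finally show ?thesis using 1 by (simp add: bd_def)
qed

text \<open>
  The end points need not belong to the set of strict convexity, so the contradiction comes from
  inside: if the divergence vanished at \<open>x\<close>, it would vanish on the whole segment, while its value at
  the midpoint is less than the mean of the values at one third and two thirds.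
\<close>

lemma bd_pos:
  assumes "x \<in> D" "y \<in> U" "x \<noteq> y" "strictly_convex_on (open_segment x y) b"
  shows "0 < bd x y"
proof (rule ccontr)
  assume "\<not> 0 < bd x y"
  define p where "p = (\<lambda>t. y + t *\<^sub>R (x - y))"
  have p_dom: "p t \<in> D" if "0 \<le> t" "t \<le> 1" for t
    unfolding p_def using that assms U_subset by (intro segment_in_dom) auto
  have p_seg: "p t \<in> open_segment x y" if "0 < t" "t < 1" for t
    unfolding p_def in_segment using that assms(3)
    by (intro conjI exI[of _ "1 - t"]) (auto simp: algebra_simps)
  have p_le: "bd (p t) y \<le> 0" if "0 \<le> t" "t \<le> 1" for t
  proof -
    have "bd (p t) y \<le> t * bd x y" unfolding p_def using that assms by (intro bd_scale)
    also have "\<dots> \<le> 0" using \<open>\<not> 0 < bd x y\<close> that by (simp add: mult_nonneg_nonpos)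
    finally show ?thesis .
  qed
  have "p (1/3) \<noteq> p (2/3)" using assms(3) by (simp add: p_def)
  then have "b ((1/2) *\<^sub>R p (1/3) + (1 - 1/2) *\<^sub>R p (2/3))
      < ereal (1/2) * b (p (1/3)) + ereal (1 - 1/2) * b (p (2/3))"
    using p_seg[of "1/3"] p_seg[of "2/3"]
    by (intro assms(4)[unfolded strictly_convex_on_def, rule_format]) auto
  moreover have "l *\<^sub>R p s + (1 - l) *\<^sub>R p t = p (l * s + (1 - l) * t)" for l s t
    by (simp add: p_def algebra_simps)
  from this[of "1/2" "1/3" "2/3"] have "(1/2) *\<^sub>R p (1/3) + (1 - 1/2) *\<^sub>R p (2/3) = p (1/2)"
    by simp
  ultimately have "2 * f (p (1/2)) < f (p (1/3)) + f (p (2/3))"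
    using p_dom by (simp add: b_eq)
  moreover have "2 * grad y (p (1/2) - y) = grad y (p (1/3) - y) + grad y (p (2/3) - y)"
    by (simp add: p_def blinfun.scaleR_right)
  ultimately have "2 * bd (p (1/2)) y < bd (p (1/3)) y + bd (p (2/3)) y"
    by (simp add: bd_def)
  then show False
    using p_le[of "1/3"] p_le[of "2/3"] bd_nonneg[OF p_dom[of "1/2"] assms(2)] by simp
qed

lemma open_segment_subset_U:
  assumes "x \<in> D" "y \<in> U"
  shows "open_segment x y \<subseteq> U"
proof
  fix w assume "w \<in> open_segment x y"
  then obtain t where t: "0 < t" "t < 1" "w = (1 - t) *\<^sub>R x + t *\<^sub>R y"
    by (auto simp: in_segment)
  then have "w = x + t *\<^sub>R (y - x)" by (simp add: algebra_simps)
  then show "w \<in> U" using segment_in_interior[OF assms] t by simp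
qed

lemma bd_pos_strictly_convex:
  assumes "strictly_convex_on U b" "x \<in> D" "y \<in> U" "x \<noteq> y"
  shows "0 < bd x y"
  using assms open_segment_subset_U[of x y]
  by (intro bd_pos) (auto simp: strictly_convex_on_def subset_iff)

section \<open>Gauges bound the divergence from below\<close>

text \<open>
  A gauge may be infinite, but not at a distance that is attained: the inequality with weight one half
  has a finite right-hand side. Gauge inequalities thus become inequalities between reals.
\<close>

lemma relative_gauge_finite:
  assumes "relative_gauge b S T \<psi>" "x \<in> S" "y \<in> T"
  obtains c where "0 \<le> c" "\<psi> (norm (x - y)) = ereal c"
    and "\<And>t. \<lbrakk>0 < t; t < 1\<rbrakk> \<Longrightarrow>
           f (t *\<^sub>R x + (1 - t) *\<^sub>R y) + t * (1 - t) * c \<le> t * f x + (1 - t) * f y"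
proof -
  have xy: "x \<in> D" "y \<in> D" and "0 \<le> \<psi> (norm (x - y))"
    using assms unfolding relative_gauge_def by auto
  have *: "ereal (f (t *\<^sub>R x + (1 - t) *\<^sub>R y)) + ereal (t * (1 - t)) * \<psi> (norm (x - y))
      \<le> ereal (t * f x + (1 - t) * f y)" if "0 < t" "t < 1" for t
  proof -
    have "b (t *\<^sub>R x + (1 - t) *\<^sub>R y) + ereal (t * (1 - t)) * \<psi> (norm (x - y))
        \<le> ereal t * b x + ereal (1 - t) * b y"
      using assms that unfolding relative_gauge_def by auto
    then show ?thesis
      using xy convex_comb(1)[OF xy that] by (simp add: b_eq)
  qed
  obtain c where c: "\<psi> (norm (x - y)) = ereal c"
    using *[of "1/2"] \<open>0 \<le> \<psi> (norm (x - y))\<close> by (cases "\<psi> (norm (x - y))") auto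
  show thesis
  proof (rule that[OF _ c])
    show "0 \<le> c" using \<open>0 \<le> \<psi> (norm (x - y))\<close> c by simp
    show "f (t *\<^sub>R x + (1 - t) *\<^sub>R y) + t * (1 - t) * c \<le> t * f x + (1 - t) * f y"
      if "0 < t" "t < 1" for t using *[OF that] c by simp
  qed
qed

lemma gauge_le_bregman_div:
  assumes "relative_gauge b S T \<psi>" "x \<in> S" "y \<in> T" "y \<in> U"
  shows "\<psi> (norm (x - y)) \<le> bregman_div b x y"
proof -
  obtain c where c: "\<psi> (norm (x - y)) = ereal c"
    "\<And>t. \<lbrakk>0 < t; t < 1\<rbrakk> \<Longrightarrow>
       f (t *\<^sub>R x + (1 - t) *\<^sub>R y) + t * (1 - t) * c \<le> t * f x + (1 - t) * f y"
    using relative_gauge_finite[OF assms(1-3)] by blast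
  have "x \<in> D" using assms(1,2) unfolding relative_gauge_def by auto
  with assms(4) show ?thesis
    using le_bd[OF _ _ c(2)] by (simp add: c(1) bregman_div_eq)
qed

text \<open>
  The modulus is the largest gauge: each gauge is a lower bound for the set of which it is the
  infimum, which also gives its positivity.
\<close>

lemma relative_gauge_convexity_modulus:
  assumes "relative_gauge b S T \<psi>"
  shows "relative_gauge b S T (convexity_modulus b S T)"
proof -
  define q where "q = (\<lambda>l x y. (l * f x + (1 - l) * f y - f (l *\<^sub>R x + (1 - l) *\<^sub>R y)) / (l * (1 - l)))"
  have ST: "S \<subseteq> D" "T \<subseteq> D" using assms unfolding relative_gauge_def by auto
  have quot: "(ereal l * b x + ereal (1 - l) * b y - b (l *\<^sub>R x + (1 - l) *\<^sub>R y)) / ereal (l * (1 - l))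
      = ereal (q l x y)" if "x \<in> S" "y \<in> T" "0 < l" "l < 1" for l x y
    using that ST convex_comb(1)[of x y l] by (auto simp: b_eq q_def subset_iff)
  have ge: "\<psi> t \<le> convexity_modulus b S T t" for t
    unfolding convexity_modulus_def
  proof (rule Inf_greatest, clarsimp simp del: ereal_divide times_ereal.simps)
    fix l :: real and x y assume *: "x \<in> S" "y \<in> T" "0 < l" "l < 1" "t = norm (x - y)"
    obtain c where "\<psi> (norm (x - y)) = ereal c"
      "f (l *\<^sub>R x + (1 - l) *\<^sub>R y) + l * (1 - l) * c \<le> l * f x + (1 - l) * f y"
      using relative_gauge_finite[OF assms *(1,2)] *(3,4) by metis
    then show "\<psi> (norm (x - y))
        \<le> (ereal l * b x + ereal (1 - l) * b y - b (l *\<^sub>R x + (1 - l) *\<^sub>R y)) / ereal (l * (1 - l))"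
      unfolding quot[OF *(1-4)] using *(3,4) by (simp add: q_def pos_le_divide_eq mult.commute)
  qed
  have "b (l *\<^sub>R x + (1 - l) *\<^sub>R y) + ereal (l * (1 - l)) * convexity_modulus b S T (norm (x - y))
      \<le> ereal l * b x + ereal (1 - l) * b y"
    if *: "x \<in> S" "y \<in> T" "0 < l" "l < 1" for l x y
  proof -
    have "convexity_modulus b S T (norm (x - y)) \<le> ereal (q l x y)"
      unfolding convexity_modulus_def quot[OF *, symmetric] using * by (intro Inf_lower) auto
    then have "ereal (l * (1 - l)) * convexity_modulus b S T (norm (x - y)) \<le> ereal (l * (1 - l)) * ereal (q l x y)"
      using * by (intro ereal_mult_left_mono) auto
    also have "\<dots> = ereal (l * f x + (1 - l) * f y - f (l *\<^sub>R x + (1 - l) *\<^sub>R y))"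
      using * by (simp add: q_def)
    finally have "b (l *\<^sub>R x + (1 - l) *\<^sub>R y) + ereal (l * (1 - l)) * convexity_modulus b S T (norm (x - y))
       \<le> b (l *\<^sub>R x + (1 - l) *\<^sub>R y) + \<dots>"
      by (rule add_left_mono)
    also have "\<dots> = ereal l * b x + ereal (1 - l) * b y"
      using * ST convex_comb(1)[of x y l] by (auto simp: b_eq subset_iff)
    finally show ?thesis .
  qed
  moreover have "0 \<le> convexity_modulus b S T t" if "0 \<le> t" for t
    using assms that order_trans[OF _ ge[of t], of 0] unfolding relative_gauge_def by blast
  moreover have "0 < convexity_modulus b S T t" if "0 < t" for t
    using assms that less_le_trans[OF _ ge[of t], of 0] unfolding relative_gauge_def by blast
  ultimately show ?thesis
    using assms unfolding relative_gauge_def by auto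
qed

text \<open>
  The value \<open>\<psi> (norm (x - y))\<close> can be compared with \<open>e\<close> only if the distance is within reach of the
  monotonicity of \<open>\<psi>\<close>, which is what the last hypothesis provides.
\<close>

lemma norm_le_gauge_inverse:
  assumes "relative_gauge b S T \<psi>" "x \<in> S" "y \<in> T" "y \<in> U"
    and "is_interval J" "strict_mono_on J \<psi>" "e \<in> \<psi> ` J" "bregman_div b x y \<le> e"
    and "J \<subseteq> {0..}" "strict_mono_on {0..} \<psi> \<or> (\<exists>s\<in>J. norm (x - y) \<le> s)"
  shows "norm (x - y) \<le> the_inv_into J \<psi> e"
proof (rule ccontr)
  define s0 where "s0 = the_inv_into J \<psi> e"
  have inj: "inj_on \<psi> J"
    using assms(6) strict_mono_on_imp_inj_on by blast
  have s0: "s0 \<in> J" "\<psi> s0 = e"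
    using the_inv_into_into[OF inj assms(7) subset_refl] f_the_inv_into_f[OF inj assms(7)]
    by (simp_all add: s0_def)
  assume "\<not> ?thesis"
  then have less: "s0 < norm (x - y)" by (simp add: s0_def)
  have "\<psi> s0 < \<psi> (norm (x - y))"
    using assms(10)
  proof
    assume "strict_mono_on {0..} \<psi>"
    then show ?thesis
      using less s0(1) assms(9) by (intro strict_mono_onD[of "{0..}" \<psi>]) auto
  next
    assume "\<exists>s\<in>J. norm (x - y) \<le> s"
    then have "norm (x - y) \<in> J"
      using assms(5) s0(1) less unfolding is_interval_1 by (meson less_imp_le)
    then show ?thesis
      using less s0(1) by (intro strict_mono_onD[OF assms(6)]) auto
  qed
  then show False
    using gauge_le_bregman_div[OF assms(1-4)] assms(8) s0(2) by simp
qed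

text \<open>
  The intermediate value theorem puts \<open>\<gamma>\<close> into the range of the gauge.
\<close>

lemma norm_le_coercive_gauge_inverse:
  assumes "relative_gauge b S T \<psi>" "x \<in> S" "y \<in> T" "y \<in> U"
    and "\<psi> 0 = 0" "continuous_on {0..} \<psi>" "strict_mono_on {0..} \<psi>" "(\<psi> \<longlongrightarrow> \<infinity>) at_top"
    and "0 \<le> \<gamma>" "bregman_div b x y \<le> ereal \<gamma>"
  shows "norm (x - y) \<le> the_inv_into {0..} \<psi> (ereal \<gamma>)"
proof (rule norm_le_gauge_inverse[OF assms(1-4) _ assms(7) _ assms(10)])
  have "eventually (\<lambda>t. ereal \<gamma> < \<psi> t) at_top"
    using assms(8) by (simp add: tendsto_PInfty)
  then have "eventually (\<lambda>t. ereal \<gamma> < \<psi> t \<and> 0 \<le> t) at_top"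
    using eventually_ge_at_top by (rule eventually_conj)
  then obtain t where "0 \<le> t" "ereal \<gamma> < \<psi> t"
    using eventually_happens by fastforce
  then have "\<exists>s\<ge>0. s \<le> t \<and> \<psi> s = ereal \<gamma>"
    using assms(5,6,9) by (intro IVT') (auto intro: continuous_on_subset)
  then show "ereal \<gamma> \<in> \<psi> ` {0..}" by force
qed (use assms(7) in auto)

lemma coercive_gauge_imp_norm_bounded:
  assumes "relative_gauge b S T \<psi>" "(\<psi> \<longlongrightarrow> \<infinity>) at_top"
  obtains R where "\<And>x y. \<lbrakk>x \<in> S; y \<in> T; y \<in> U; bregman_div b x y \<le> ereal K\<rbrakk> \<Longrightarrow> norm (x - y) \<le> R"
proof -
  have "eventually (\<lambda>t. ereal K < \<psi> t) at_top"
    using assms(2) by (simp add: tendsto_PInfty)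
  then obtain R where R: "\<And>t. R \<le> t \<Longrightarrow> ereal K < \<psi> t"
    unfolding eventually_at_top_linorder by blast
  show thesis
  proof (rule that, rule ccontr)
    fix x y assume *: "x \<in> S" "y \<in> T" "y \<in> U" "bregman_div b x y \<le> ereal K" "\<not> norm (x - y) \<le> R"
    then have "ereal K < \<psi> (norm (x - y))" using R by simp
    also have "\<dots> \<le> bregman_div b x y" using gauge_le_bregman_div[OF assms(1) *(1-3)] .
    finally show False using *(4) by simp
  qed
qed

lemma strict_gauge_minorant:
  fixes x y :: "nat \<Rightarrow> 'a"
  assumes "relative_gauge b S T \<psi>" "strict_mono_on {0..} \<psi>" "\<psi> 0 = 0"
    and "\<And>i. x i \<in> S" "\<And>i. y i \<in> T" "\<And>i. y i \<in> U" "0 < \<epsilon>"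
  shows "\<exists>c>0. \<forall>i. \<epsilon> \<le> norm (x i - y i) \<longrightarrow> c \<le> bregman_div b (x i) (y i)"
proof (intro exI[of _ "\<psi> \<epsilon>"] conjI allI impI)
  show "0 < \<psi> \<epsilon>" using strict_mono_onD[OF assms(2), of 0 \<epsilon>] assms(3,7) by simp
  fix i assume "\<epsilon> \<le> norm (x i - y i)"
  then have "\<psi> \<epsilon> \<le> \<psi> (norm (x i - y i))"
    using strict_mono_onD[OF assms(2), of \<epsilon> "norm (x i - y i)"] assms(7) by (cases "\<epsilon> = norm (x i - y i)") auto
  also have "\<dots> \<le> bregman_div b (x i) (y i)"
    using gauge_le_bregman_div[OF assms(1,4,5,6)] .
  finally show "\<psi> \<epsilon> \<le> bregman_div b (x i) (y i)" .
qed

text \<open>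
  Linear growth of the divergence for points at distance at least \<open>\<epsilon>\<close>: move \<open>x\<close> towards \<open>y\<close> to distance
  exactly \<open>\<epsilon>\<close>, where the gauge applies, and scale back by convexity in the first argument.
\<close>

lemma uniformly_convex_growth:
  assumes "uniformly_convex_on b S" "convex S" "0 < \<epsilon>"
  obtains c where "0 < c"
    and "\<And>x y. \<lbrakk>x \<in> S; y \<in> S; y \<in> U; \<epsilon> \<le> norm (x - y)\<rbrakk> \<Longrightarrow> c * norm (x - y) \<le> bd x y"
proof -
  obtain \<psi> where \<psi>: "relative_gauge b S S \<psi>"
    using assms(1) unfolding uniformly_convex_rel_def by blast
  then have "S \<subseteq> D" and "0 < \<psi> \<epsilon>" using assms(3) unfolding relative_gauge_def by auto
  \<comment> \<open>If \<open>\<psi> \<epsilon>\<close> is infinite, no two points of \<open>S\<close>, the second one interior, have distance \<open>\<epsilon>\<close> or more.\<close>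
  define c where "c = (if \<psi> \<epsilon> = \<infinity> then 1 else real_of_ereal (\<psi> \<epsilon>) / \<epsilon>)"
  have "0 < c"
    using \<open>0 < \<psi> \<epsilon>\<close> assms(3) by (cases "\<psi> \<epsilon>") (auto simp: c_def)
  moreover have "c * norm (x - y) \<le> bd x y"
    if *: "x \<in> S" "y \<in> S" "y \<in> U" "\<epsilon> \<le> norm (x - y)" for x y
  proof -
    define n where "n = norm (x - y)"
    have n: "0 < n" "\<epsilon> \<le> n" using * assms(3) by (auto simp: n_def)
    define z where "z = y + (\<epsilon> / n) *\<^sub>R (x - y)"
    have t: "0 \<le> \<epsilon> / n" "\<epsilon> / n \<le> 1" using n assms(3) by auto
    have "z = (1 - \<epsilon> / n) *\<^sub>R y + (\<epsilon> / n) *\<^sub>R x"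
      by (simp add: z_def algebra_simps)
    then have "z \<in> S" using * t by (auto intro!: convexD[OF assms(2)])
    moreover have "norm (z - y) = \<epsilon>"
      using n assms(3) by (simp add: z_def n_def)
    ultimately have "\<psi> \<epsilon> \<le> ereal (bd z y)"
      using gauge_le_bregman_div[OF \<psi>, of z y] * \<open>S \<subseteq> D\<close> bregman_div_eq[of z y] by (auto simp: subset_iff)
    then have "c * \<epsilon> \<le> bd z y"
      using \<open>0 < \<psi> \<epsilon>\<close> assms(3) by (cases "\<psi> \<epsilon>") (auto simp: c_def)
    also have "\<dots> \<le> \<epsilon> / n * bd x y"
      unfolding z_def using * \<open>S \<subseteq> D\<close> t by (intro bd_scale) auto
    finally have "\<epsilon> * (c * n) \<le> \<epsilon> * bd x y"
      using n by (simp add: field_simps)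
    then show ?thesis using assms(3) by (simp add: n_def)
  qed
  ultimately show thesis using that by blast
qed

lemma uniformly_convex_imp_norm_bounded:
  assumes "uniformly_convex_on b D"
  obtains R where "\<And>x y. \<lbrakk>x \<in> D; y \<in> U; bregman_div b x y \<le> ereal K\<rbrakk> \<Longrightarrow> norm (x - y) \<le> R"
proof -
  obtain c where c: "0 < c"
    "\<And>x y. \<lbrakk>x \<in> D; y \<in> D; y \<in> U; 1 \<le> norm (x - y)\<rbrakk> \<Longrightarrow> c * norm (x - y) \<le> bd x y"
    using uniformly_convex_growth[OF assms convex_dom zero_less_one] by blast
  have "norm (x - y) \<le> max 1 (K / c)" if *: "x \<in> D" "y \<in> U" "bregman_div b x y \<le> ereal K" for x y
  proof (cases "1 \<le> norm (x - y)")
    case True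
    then have "c * norm (x - y) \<le> K"
      using c(2)[of x y] * U_subset by (simp add: bregman_div_eq)
    then show ?thesis using c(1) by (simp add: field_simps le_max_iff_disj)
  qed simp
  then show thesis using that by blast
qed

text \<open>
  Only one of the two points is known to lie in the ball of radius \<open>R\<close>. The other one is moved towards
  it to distance \<open>\<epsilon>\<close>, hence into the ball of radius \<open>R + \<epsilon>\<close>, on which uniform convexity is available.
  Moving the first point decreases the divergence by \<open>bd_scale\<close>, moving the second one by
  \<open>bd_antimono_segment\<close>.
\<close>

lemma uniformly_convex_on_bounded_minorant:
  assumes "\<And>S. \<lbrakk>S \<noteq> {}; bounded S; convex S; S \<subseteq> D\<rbrakk> \<Longrightarrow> uniformly_convex_on b S" "0 < \<epsilon>"
  shows "\<exists>c>0. \<forall>x\<in>D. \<forall>y\<in>U. (norm x \<le> R \<or> norm y \<le> R) \<and> \<epsilon> \<le> norm (x - y) \<longrightarrow> c \<le> bd x y"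
proof (cases "D \<inter> cball 0 (R + \<epsilon>) = {}")
  case True
  then have "\<not> norm x \<le> R" if "x \<in> D" for x
    using that assms(2) by (auto simp: disjoint_iff)
  then show ?thesis using U_subset by (intro exI[of _ 1]) auto
next
  case False
  let ?S = "D \<inter> cball 0 (R + \<epsilon>)"
  have S: "convex ?S"
    using convex_dom by (intro convex_Int convex_cball)
  then have "uniformly_convex_on b ?S"
    using False by (intro assms(1)) auto
  obtain c where c: "0 < c"
    "\<And>x y. \<lbrakk>x \<in> ?S; y \<in> ?S; y \<in> U; \<epsilon> \<le> norm (x - y)\<rbrakk> \<Longrightarrow> c * norm (x - y) \<le> bd x y"
    using uniformly_convex_growth[OF \<open>uniformly_convex_on b ?S\<close> S assms(2)] by blast
  have "c * \<epsilon> \<le> bd x y"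
    if *: "x \<in> D" "y \<in> U" "norm x \<le> R \<or> norm y \<le> R" "\<epsilon> \<le> norm (x - y)" for x y
  proof -
    define n where "n = norm (x - y)"
    have n: "0 < n" "\<epsilon> \<le> n" using * assms(2) by (auto simp: n_def)
    have t: "0 < \<epsilon> / n" "\<epsilon> / n \<le> 1" using n assms(2) by auto
    show ?thesis
      using *(3)
    proof
      assume "norm y \<le> R"
      define z where "z = y + (\<epsilon> / n) *\<^sub>R (x - y)"
      have "norm (z - y) = \<epsilon>" using n assms(2) by (simp add: z_def n_def)
      moreover from this have "norm z \<le> R + \<epsilon>"
        using \<open>norm y \<le> R\<close> norm_triangle_ineq2[of z y] by simp
      moreover have "z \<in> D"
        unfolding z_def using * t U_subset by (intro segment_in_dom) auto
      ultimately have "c * \<epsilon> \<le> bd z y"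
        using c(2)[of z y] *(2) \<open>norm y \<le> R\<close> assms(2) U_subset by simp
      also have "\<dots> \<le> \<epsilon> / n * bd x y"
        unfolding z_def using * t by (intro bd_scale) auto
      also have "\<dots> \<le> bd x y"
        using t bd_nonneg[OF *(1,2)] mult_right_mono[of "\<epsilon> / n" 1 "bd x y"] by simp
      finally show ?thesis .
    next
      assume "norm x \<le> R"
      define z where "z = y + (1 - \<epsilon> / n) *\<^sub>R (x - y)"
      have "z = x + (\<epsilon> / n) *\<^sub>R (y - x)"
        by (simp add: z_def algebra_simps)
      then have "z \<in> U"
        using segment_in_interior[OF *(1,2) t] by simp
      have xz: "x - z = (\<epsilon> / n) *\<^sub>R (x - y)"
        by (simp add: z_def algebra_simps)
      have "norm (x - z) = \<epsilon>" unfolding xz using n assms(2) by (simp add: n_def)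
      moreover from this have "norm z \<le> R + \<epsilon>"
        using \<open>norm x \<le> R\<close> norm_triangle_ineq2[of z x] by (simp add: norm_minus_commute)
      ultimately have "c * \<epsilon> \<le> bd x z"
        using c(2)[of x z] *(1) \<open>z \<in> U\<close> \<open>norm x \<le> R\<close> assms(2) U_subset by simp
      also have "\<dots> \<le> bd x y"
        unfolding z_def using * t by (intro bd_antimono_segment) auto
      finally show ?thesis .
    qed
  qed
  then show ?thesis using c(1) assms(2) by (intro exI[of _ "c * \<epsilon>"]) auto
qed

lemma uniformly_convex_on_bounded_imp_dist_tendsto_0:
  fixes x y :: "nat \<Rightarrow> 'a"
  assumes "\<And>S. \<lbrakk>S \<noteq> {}; bounded S; convex S; S \<subseteq> D\<rbrakk> \<Longrightarrow> uniformly_convex_on b S"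
    and "\<And>i. x i \<in> D" "\<And>i. y i \<in> U" "(\<lambda>i. bregman_div b (x i) (y i)) \<longlonglongrightarrow> 0"
    and "bounded (range x) \<or> bounded (range y)"
  shows "(\<lambda>i. norm (x i - y i)) \<longlonglongrightarrow> 0"
proof (rule tendsto_0_if_minorized[OF assms(4)])
  fix \<epsilon> :: real assume "0 < \<epsilon>"
  obtain R where R: "(\<forall>i. norm (x i) \<le> R) \<or> (\<forall>i. norm (y i) \<le> R)"
    using assms(5) by (auto simp: bounded_iff)
  obtain c where "c > 0"
    "\<forall>x\<in>D. \<forall>y\<in>U. (norm x \<le> R \<or> norm y \<le> R) \<and> \<epsilon> \<le> norm (x - y) \<longrightarrow> c \<le> bd x y"
    using uniformly_convex_on_bounded_minorant[OF assms(1) \<open>0 < \<epsilon>\<close>] by blast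
  with R assms(2,3) show "\<exists>c>0. \<forall>i. \<epsilon> \<le> norm (x i - y i) \<longrightarrow> c \<le> bregman_div b (x i) (y i)"
    by (intro exI[of _ "ereal c"]) (auto simp: bregman_div_eq)
qed simp

section \<open>The divergence as a function of its first argument\<close>

lemma edom_bregman_div: "y \<in> U \<Longrightarrow> edom (\<lambda>x. bregman_div b x y) = D"
  by (auto simp: edom_def[of "\<lambda>x. bregman_div b x y"] bregman_div_eq) (auto simp: bregman_div_def split: if_splits)

text \<open>
  In the first argument the divergence differs from \<open>f\<close> by an affine function, so both have the same
  convexity defect.
\<close>

lemma bd_comb:
  "bd (l *\<^sub>R x + (1 - l) *\<^sub>R z) y - (l * bd x y + (1 - l) * bd z y)
    = f (l *\<^sub>R x + (1 - l) *\<^sub>R z) - (l * f x + (1 - l) * f z)"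
proof -
  have "l *\<^sub>R x + (1 - l) *\<^sub>R z - y = l *\<^sub>R (x - y) + (1 - l) *\<^sub>R (z - y)"
    by (simp add: algebra_simps)
  then have "grad y (l *\<^sub>R x + (1 - l) *\<^sub>R z - y) = l * grad y (x - y) + (1 - l) * grad y (z - y)"
    by (simp only: blinfun.add_right blinfun.scaleR_right real_scaleR_def)
  then show ?thesis unfolding bd_def by argo
qed

lemma convex_efun_bregman_div:
  assumes "y \<in> U"
  shows "convex_efun (\<lambda>x. bregman_div b x y)"
  unfolding convex_efun_def
proof (intro conjI allI ballI)
  show "bregman_div b x y \<noteq> -\<infinity>" for x
    using bregman_div_nonneg[of x y] by auto
  fix x z :: 'a and l :: real assume l: "l \<in> {0<..<1}"
  show "bregman_div b (l *\<^sub>R x + (1 - l) *\<^sub>R z) y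
      \<le> ereal l * bregman_div b x y + ereal (1 - l) * bregman_div b z y"
  proof (cases "x \<in> D \<and> z \<in> D")
    case True
    then show ?thesis
      using l assms convex_comb[of x z l] bd_comb[of l x z y] by (simp add: bregman_div_eq)
  next
    case False
    then have "bregman_div b x y = \<infinity> \<or> bregman_div b z y = \<infinity>"
      by (auto simp: bregman_div_def)
    then have "ereal l * bregman_div b x y + ereal (1 - l) * bregman_div b z y = \<infinity>"
      using l bregman_div_nonneg[of x y] bregman_div_nonneg[of z y]
      by (cases "bregman_div b x y"; cases "bregman_div b z y") auto
    then show ?thesis by (simp only: ereal_less_eq)
  qed
qed

lemma lsc_efun_bregman_div:
  assumes "lsc_efun b" "y \<in> U"
  shows "lsc_efun (\<lambda>x. bregman_div b x y)"
  unfolding lsc_efun_def le_Liminf_iff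
proof (intro allI impI)
  fix x and k :: ereal assume k: "k < bregman_div b x y"
  define c where "c = (\<lambda>u. - f y - grad y (u - y))"
  have eq: "bregman_div b u y = b u + ereal (c u)" for u
  proof (cases "u \<in> D")
    case True
    then show ?thesis using assms(2) by (simp add: c_def bregman_div_eq b_eq bd_def)
  next
    case False
    then have "b u = \<infinity>" by (simp add: edom_def)
    moreover have "bregman_div b u y = \<infinity>" using False by (simp add: bregman_div_def)
    ultimately show ?thesis by simp
  qed
  show "eventually (\<lambda>u. k < bregman_div b u y) (nhds x)"
  proof (cases k)
    case (real r)
    have "ereal (r - c x) < b x"
      using k unfolding real eq by (cases "b x") auto
    then obtain m where m: "ereal (r - c x) < ereal m" "ereal m < b x"
      using ereal_dense2 by blast
    have "eventually (\<lambda>u. ereal m < b u) (nhds x)"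
      using assms(1) m(2) unfolding lsc_efun_def le_Liminf_iff by blast
    moreover have "isCont c x"
      unfolding c_def by (intro continuous_intros)
    then have "(c \<longlongrightarrow> c x) (nhds x)"
      by (simp add: continuous_at tendsto_nhds_iff)
    then have "eventually (\<lambda>u. r - m < c u) (nhds x)"
      using m(1) by (intro order_tendstoD) auto
    ultimately show ?thesis
    proof eventually_elim
      case (elim u)
      then show ?case unfolding real eq by (cases "b u") auto
    qed
  next
    case MInf
    have "-\<infinity> < bregman_div b u y" for u
      using bregman_div_nonneg[of u y] by (simp add: less_le_trans[of "-\<infinity>" 0])
    then show ?thesis by (simp add: MInf)
  qed (use k in simp)
qed

lemma relative_gauge_bregman_div:
  assumes "relative_gauge b S T \<psi>" "y \<in> U"
  shows "relative_gauge (\<lambda>x. bregman_div b x y) S T \<psi>"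
proof -
  have ST: "S \<subseteq> D" "T \<subseteq> D" using assms unfolding relative_gauge_def by auto
  have "bregman_div b (l *\<^sub>R x + (1 - l) *\<^sub>R z) y + ereal (l * (1 - l)) * \<psi> (norm (x - z))
      \<le> ereal l * bregman_div b x y + ereal (1 - l) * bregman_div b z y"
    if *: "x \<in> S" "z \<in> T" "0 < l" "l < 1" for l x z
  proof -
    obtain c where c: "\<psi> (norm (x - z)) = ereal c"
      "f (l *\<^sub>R x + (1 - l) *\<^sub>R z) + l * (1 - l) * c \<le> l * f x + (1 - l) * f z"
      using relative_gauge_finite[OF assms(1) *(1,2)] *(3,4) by metis
    have "x \<in> D" "z \<in> D" using * ST by auto
    then show ?thesis
      using * assms(2) convex_comb(1)[of x z l] bd_comb[of l x z y] c by (simp add: bregman_div_eq)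
  qed
  then show ?thesis
    using assms convex_efun_bregman_div[OF assms(2)]
    unfolding relative_gauge_def edom_bregman_div[OF assms(2)] by auto
qed

section \<open>Vanishing divergence and strict convexity\<close>

text \<open>
  The values \<open>b (x i)\<close> are the divergences plus terms that converge to \<open>f z + grad z (l - z)\<close>. Lower
  semicontinuity makes \<open>b l\<close> finite, even if the domain is not closed, and the divergence at the limit
  at most 0.
\<close>

lemma bd_limit_eq_0:
  fixes x y :: "nat \<Rightarrow> 'a"
  assumes "lsc_efun b" "\<And>i. x i \<in> D" "\<And>i. y i \<in> U" "z \<in> U"
    and "x \<longlonglongrightarrow> l" "y \<longlonglongrightarrow> z" "(\<lambda>i. f (y i)) \<longlonglongrightarrow> f z" "(\<lambda>i. grad (y i)) \<longlonglongrightarrow> grad z"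
    and "(\<lambda>i. bd (x i) (y i)) \<longlonglongrightarrow> 0"
  shows "l \<in> D" "bd l z = 0"
proof -
  define c where "c = (\<lambda>i. bd (x i) (y i) + f (y i) + grad (y i) (x i - y i))"
  have "c \<longlonglongrightarrow> 0 + f z + grad z (l - z)"
    unfolding c_def using assms by (intro tendsto_intros blinfun.tendsto)
  moreover have "b (x i) \<le> ereal (c i)" for i
    using assms(2) by (simp add: b_eq c_def bd_def)
  ultimately have *: "b l \<le> ereal (0 + f z + grad z (l - z))"
    using assms(1,5) by (intro lsc_efun_le_limit[of b x l c]) auto
  then show l: "l \<in> D" by (rule in_domI)
  have "bd l z \<le> 0" using * l by (simp add: b_eq bd_def)
  then show "bd l z = 0" using bd_nonneg[OF l assms(4)] by simp
qed

lemma bd_tendsto_0_imp_tendsto: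
  fixes x y :: "nat \<Rightarrow> 'a"
  assumes "lsc_efun b" "strictly_convex_on U b" "\<And>i. x i \<in> D" "\<And>i. y i \<in> U" "z \<in> U"
    and "y \<longlonglongrightarrow> z" "(\<lambda>i. f (y i)) \<longlonglongrightarrow> f z" "(\<lambda>i. grad (y i)) \<longlonglongrightarrow> grad z"
    and "(\<lambda>i. bd (x i) (y i)) \<longlonglongrightarrow> 0"
    and subseq: "\<And>r :: nat \<Rightarrow> nat. strict_mono r \<Longrightarrow> \<exists>s l. strict_mono s \<and> (\<lambda>i. x (r (s i))) \<longlonglongrightarrow> l"
  shows "x \<longlonglongrightarrow> z"
proof (rule LIMSEQ_if_subsequences)
  fix r :: "nat \<Rightarrow> nat" assume "strict_mono r"
  then obtain s l where s: "strict_mono s" "(\<lambda>i. x (r (s i))) \<longlonglongrightarrow> l"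
    using subseq by blast
  have "strict_mono (\<lambda>i. r (s i))"
    using \<open>strict_mono r\<close> s(1) by (simp add: strict_mono_def)
  note sub = LIMSEQ_subseq_LIMSEQ[OF _ this, unfolded o_def]
  have "l \<in> D" "bd l z = 0"
    using bd_limit_eq_0[OF assms(1,3,4,5) s(2) sub[OF assms(6)] sub[OF assms(7)] sub[OF assms(8)] sub[OF assms(9)]]
    by auto
  then have "l = z"
    using bd_pos_strictly_convex[OF assms(2) _ assms(5), of l] by fastforce
  then show "\<exists>s. strict_mono s \<and> (\<lambda>i. x (r (s i))) \<longlonglongrightarrow> z"
    using s by blast
qed

text \<open>
  On the unit sphere around \<open>y\<close> the divergence is bounded below by some \<open>c > 0\<close>: otherwise points of
  the sphere with vanishing divergence would converge to \<open>y\<close>. By convexity the divergence then grows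
  at least like \<open>c * norm (x - y)\<close> outside the sphere.
\<close>

lemma fin_dim_strictly_convex_imp_bounded_level2:
  assumes "lsc_efun b" "fin_dim TYPE('a)" "strictly_convex_on U b" "y \<in> U"
  shows "bounded (level2 b y K)"
proof -
  have "\<exists>c>0. \<forall>x\<in>D. norm (x - y) = 1 \<longrightarrow> c \<le> bd x y"
  proof (rule ccontr)
    assume "\<not> ?thesis"
    then have "\<exists>x\<in>D. norm (x - y) = 1 \<and> bd x y < 1 / real (Suc n)" for n
      by (metis not_less of_nat_0_less_iff zero_less_Suc zero_less_divide_1_iff)
    then obtain x where x: "\<And>n. x n \<in> D" "\<And>n. norm (x n - y) = 1" "\<And>n. bd (x n) y < 1 / real (Suc n)"
      by metis
    have "norm (x n) \<le> 1 + norm y" for n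
      using norm_triangle_ineq2[of "x n" y] x(2)[of n] by simp
    then have bdd: "bounded (range x)" by (auto simp: bounded_iff)
    have lim: "(\<lambda>n. bd (x n) y) \<longlonglongrightarrow> 0"
    proof (rule tendsto_sandwich[OF _ _ tendsto_const])
      show "(\<lambda>n. 1 / real (Suc n)) \<longlonglongrightarrow> 0"
        using LIMSEQ_inverse_real_of_nat by (simp add: inverse_eq_divide)
      show "eventually (\<lambda>n. 0 \<le> bd (x n) y) sequentially"
        using x(1) assms(4) by (intro always_eventually allI bd_nonneg)
      show "eventually (\<lambda>n. bd (x n) y \<le> 1 / real (Suc n)) sequentially"
        using x(3) by (intro always_eventually allI less_imp_le)
    qed
    have sub: "\<exists>s l. strict_mono s \<and> (\<lambda>i. x (r (s i))) \<longlonglongrightarrow> l" for r :: "nat \<Rightarrow> nat"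
    proof -
      have "bounded (range (x \<circ> r))" using bdd by (rule bounded_subset) auto
      then obtain l s where "strict_mono s" "((x \<circ> r) \<circ> s) \<longlonglongrightarrow> l"
        by (rule fin_dim_bounded_subsequence[OF assms(2)])
      then show ?thesis unfolding comp_def by blast
    qed
    have "x \<longlonglongrightarrow> y"
    proof (rule bd_tendsto_0_imp_tendsto[where x = x and y = "\<lambda>_. y" and z = y])
      show "\<exists>s l. strict_mono s \<and> (\<lambda>i. x (r (s i))) \<longlonglongrightarrow> l" for r :: "nat \<Rightarrow> nat"
        by (rule sub)
    qed (rule assms x lim tendsto_const)+
    from tendsto_norm[OF tendsto_diff[OF this tendsto_const[of y]]] show False
      by (simp add: x(2) LIMSEQ_const_iff)
  qed
  then obtain c where c: "c > 0" "\<And>x. x \<in> D \<Longrightarrow> norm (x - y) = 1 \<Longrightarrow> c \<le> bd x y" by blast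
  have "norm (x - y) \<le> max 1 (K / c)" if "x \<in> level2 b y K" for x
  proof (cases "1 \<le> norm (x - y)")
    case True
    define n where "n = norm (x - y)"
    have x: "x \<in> D" "bd x y \<le> K"
      using that assms(4) by (auto simp: level2_def bregman_div_eq)
    define z where "z = y + (1 / n) *\<^sub>R (x - y)"
    have "1 \<le> n" using True by (simp add: n_def)
    then have n: "0 \<le> 1 / n" "1 / n \<le> 1" "0 < n" by (auto simp: divide_le_eq_1)
    have "z \<in> D" unfolding z_def using x n assms(4) U_subset by (intro segment_in_dom) auto
    moreover have "norm (z - y) = 1" using n by (simp add: z_def n_def)
    ultimately have "c \<le> bd z y" by (rule c(2))
    also have "\<dots> \<le> 1 / n * bd x y" unfolding z_def using x n assms(4) by (intro bd_scale) auto
    finally have "c * n \<le> K" using n x(2) by (simp add: field_simps)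
    then show ?thesis using c(1) by (simp add: n_def field_simps le_max_iff_disj)
  qed simp
  then show ?thesis
    unfolding bounded_def by (intro exI[of _ y]) (auto simp: dist_norm norm_minus_commute)
qed

section \<open>Bounded derivatives bound the divergence from above\<close>

lemma bounded_grad_obtain:
  assumes "bounded_on_bounded_convex grad U"
  obtains M where "\<And>u. u \<in> U \<Longrightarrow> norm u \<le> R \<Longrightarrow> norm (grad u) \<le> M"
proof -
  have "convex (U \<inter> cball 0 R)" "bounded (U \<inter> cball 0 R)"
    using convex_dom by (auto intro!: convex_Int)
  then have "bounded (grad ` (U \<inter> cball 0 R))"
    using assms unfolding bounded_on_bounded_convex_def by blast
  then obtain M where "\<And>u. u \<in> U \<inter> cball 0 R \<Longrightarrow> norm (grad u) \<le> M"
    unfolding bounded_iff by blast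
  then show thesis
    using that[of M] by simp
qed

lemma bd_le_on_bounded_sets:
  assumes "lsc_efun b" "bounded_on_bounded_convex grad U"
  obtains M where "\<And>x y. \<lbrakk>x \<in> D; y \<in> U; norm x \<le> R; norm y \<le> R\<rbrakk> \<Longrightarrow> bd x y \<le> M * norm (x - y)"
proof -
  obtain M where M: "\<And>u. u \<in> U \<Longrightarrow> norm u \<le> R \<Longrightarrow> norm (grad u) \<le> M"
    using bounded_grad_obtain[OF assms(2)] by blast
  show thesis
  proof (rule that)
    fix x y assume *: "x \<in> D" "y \<in> U" "norm x \<le> R" "norm y \<le> R"
    then have "closed_segment x y \<subseteq> cball 0 R"
      by (intro closed_segment_subset) auto
    then show "bd x y \<le> 2 * M * norm (x - y)"
      using M * by (intro bd_le_grad_bound[OF assms(1)]) auto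
  qed
qed

lemma bd_tendsto_0_if_le:
  fixes x y :: "nat \<Rightarrow> 'a"
  assumes "\<And>i. x i \<in> D" "\<And>i. y i \<in> U" "(\<lambda>i. norm (x i - y i)) \<longlonglongrightarrow> 0"
    and "eventually (\<lambda>i. bd (x i) (y i) \<le> M * norm (x i - y i)) sequentially"
  shows "(\<lambda>i. bregman_div b (x i) (y i)) \<longlonglongrightarrow> 0"
proof -
  have "(\<lambda>i. M * norm (x i - y i)) \<longlonglongrightarrow> 0"
    using assms(3) by (rule tendsto_mult_right_zero)
  then have "(\<lambda>i. bd (x i) (y i)) \<longlonglongrightarrow> 0"
    using assms(1,2) by (intro tendsto_sandwich[OF _ assms(4) tendsto_const])
      (auto intro!: always_eventually bd_nonneg)
  then show ?thesis
    using assms(1,2) by (simp add: bregman_div_eq zero_ereal_def)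
qed

lemma bregman_div_tendsto_0:
  fixes x y :: "nat \<Rightarrow> 'a"
  assumes "lsc_efun b" "bounded_on_bounded_convex grad U" "\<And>i. x i \<in> D" "\<And>i. y i \<in> U"
    and "bounded (range x) \<or> bounded (range y)" "(\<lambda>i. norm (x i - y i)) \<longlonglongrightarrow> 0"
  shows "(\<lambda>i. bregman_div b (x i) (y i)) \<longlonglongrightarrow> 0"
proof -
  have "bounded (range x \<union> range y)"
    using bounded_range_if_dist_tendsto_0[OF assms(6,5)] by simp
  then obtain R where R: "\<And>i. norm (x i) \<le> R" "\<And>i. norm (y i) \<le> R"
    unfolding bounded_iff by blast
  obtain M where "\<And>x y. \<lbrakk>x \<in> D; y \<in> U; norm x \<le> R; norm y \<le> R\<rbrakk> \<Longrightarrow> bd x y \<le> M * norm (x - y)"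
    using bd_le_on_bounded_sets[OF assms(1,2)] by blast
  then show ?thesis
    using assms(3,4,6) R by (intro bd_tendsto_0_if_le[of x y M]) auto
qed

lemma bregman_div_tendsto_0_locally_bounded:
  fixes y :: "nat \<Rightarrow> 'a"
  assumes "lsc_efun b" "x \<in> U" "locally_bounded_at grad U x" "\<And>i. y i \<in> U" "(\<lambda>i. norm (x - y i)) \<longlonglongrightarrow> 0"
  shows "(\<lambda>i. bregman_div b x (y i)) \<longlonglongrightarrow> 0"
proof -
  obtain e M where e: "e > 0" and M: "\<And>u. u \<in> U \<Longrightarrow> u \<in> ball x e \<Longrightarrow> norm (grad u) \<le> M"
    using assms(3) unfolding locally_bounded_at_def bounded_iff by blast
  have "eventually (\<lambda>i. norm (x - y i) < e) sequentially"
    using assms(5) e by (rule order_tendstoD)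
  then have "eventually (\<lambda>i. bd x (y i) \<le> 2 * M * norm (x - y i)) sequentially"
  proof eventually_elim
    case (elim i)
    then have "closed_segment x (y i) \<subseteq> ball x e"
      using e by (intro closed_segment_subset) (auto simp: dist_norm)
    then show ?case
      using M assms(2,4) U_subset by (intro bd_le_grad_bound[OF assms(1)]) auto
  qed
  then show ?thesis
    using assms(2,4,5) U_subset by (intro bd_tendsto_0_if_le[of "\<lambda>_. x" y "2 * M"]) auto
qed

text \<open>
  An upper bound \<open>M\<close> for \<open>f\<close> on a ball around \<open>x\<close> gives a lower bound for \<open>f\<close> at \<open>y\<close>, since \<open>x\<close> is the
  midpoint of \<open>y\<close> and its reflection. The subgradient inequality at \<open>y\<close> then bounds the derivative in
  all directions of length half the radius.
\<close>

lemma fin_dim_locally_bounded_grad: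
  assumes "fin_dim TYPE('a)" "x \<in> U"
  shows "locally_bounded_at grad U x"
proof -
  obtain F :: "'a set" where F: "finite F" "span F = UNIV"
    using assms(1) unfolding fin_dim_def by blast
  then obtain \<delta> M where \<delta>: "\<delta> > 0" and M: "\<And>v. norm v \<le> \<delta> \<Longrightarrow> x + v \<in> D \<and> f (x + v) \<le> M"
    using convex_on_bounded_above_finite_span[OF F(1) convex_on_f assms(2)] by auto
  define K where "K = 2 * M - 2 * f x"
  have "norm (grad y) \<le> 2 * K / \<delta>" if y: "y \<in> ball x (\<delta> / 2)" "y \<in> U" for y
  proof -
    have near: "norm (y - x) < \<delta> / 2" using y(1) by (simp add: dist_norm norm_minus_commute)
    have "x + (x - y) \<in> D \<and> f (x + (x - y)) \<le> M"
      using near \<delta> by (intro M) (simp add: norm_minus_commute)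
    moreover have "(1/2) *\<^sub>R y + (1 - 1/2) *\<^sub>R (x + (x - y)) = x"
      by (simp add: algebra_simps flip: scaleR_add_left)
    ultimately have "f x \<le> 1/2 * f y + (1 - 1/2) * M"
      using convex_comb(2)[of y "x + (x - y)" "1/2"] y(2) U_subset by auto
    then have fy: "2 * f x - M \<le> f y" by simp
    have le_K: "grad y u \<le> K" if "norm u \<le> \<delta> / 2" for u
    proof -
      have "x + ((y - x) + u) \<in> D \<and> f (x + ((y - x) + u)) \<le> M"
        using near that norm_triangle_ineq[of "y - x" u] by (intro M) simp
      then have "y + u \<in> D" "f (y + u) \<le> M" by simp_all
      then have "grad y u \<le> M - f y"
        using bd_nonneg[of "y + u" y] y(2) by (simp add: bd_def)
      then show ?thesis using fy by (simp add: K_def)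
    qed
    have "0 \<le> K" using le_K[of 0] \<delta> by simp
    show ?thesis
    proof (rule norm_blinfun_bound)
      show "0 \<le> 2 * K / \<delta>" using \<open>0 \<le> K\<close> \<delta> by simp
      fix w
      show "norm (grad y w) \<le> 2 * K / \<delta> * norm w"
      proof (cases "w = 0")
        case False
        define s where "s = \<delta> / 2 / norm w"
        have "s > 0" "s * norm w = \<delta> / 2" using False \<delta> by (auto simp: s_def)
        then have "grad y (s *\<^sub>R w) \<le> K" "grad y (- (s *\<^sub>R w)) \<le> K"
          by (intro le_K; simp)+
        then have "s * \<bar>grad y w\<bar> \<le> K"
          by (cases "0 \<le> grad y w") (simp_all add: blinfun.scaleR_right blinfun.minus_right)
        then show ?thesis
          using False \<delta> by (simp add: s_def field_simps)
      qed simp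
    qed
  qed
  then show ?thesis
    unfolding locally_bounded_at_def bounded_iff using \<delta>
    by (intro exI[of _ "\<delta> / 2"] conjI exI[of _ "2 * K / \<delta>"]) auto
qed

lemma SUP_bregman_div_less_infty:
  assumes "lsc_efun b" "bounded_on_bounded_convex grad U" "x \<in> D" "S \<subseteq> U" "bounded S"
  shows "(SUP y\<in>S. bregman_div b x y) < \<infinity>"
proof -
  have "bounded (insert x S)" using assms(5) by simp
  then obtain R where R: "norm x \<le> R" "\<And>y. y \<in> S \<Longrightarrow> norm y \<le> R"
    unfolding bounded_iff by auto
  obtain M where M: "\<And>x y. \<lbrakk>x \<in> D; y \<in> U; norm x \<le> R; norm y \<le> R\<rbrakk> \<Longrightarrow> bd x y \<le> M * norm (x - y)"
    using bd_le_on_bounded_sets[OF assms(1,2)] by blast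
  have "bregman_div b x y \<le> ereal (\<bar>M\<bar> * (R + R))" if "y \<in> S" for y
  proof -
    have "norm (x - y) \<le> R + R"
      using norm_triangle_ineq4[of x y] R(1) R(2)[OF that] by simp
    have "bd x y \<le> M * norm (x - y)"
      using M[of x y] R that assms by auto
    also have "\<dots> \<le> \<bar>M\<bar> * (R + R)"
      using \<open>norm (x - y) \<le> R + R\<close> by (intro mult_mono) auto
    finally show ?thesis using that assms by (auto simp: bregman_div_eq)
  qed
  then have "(SUP y\<in>S. bregman_div b x y) \<le> ereal (\<bar>M\<bar> * (R + R))"
    by (rule SUP_least)
  then show ?thesis by (rule le_less_trans) simp
qed

section \<open>Differences of divergences\<close>

lemma bregman_div_diff_tendsto_0:
  fixes x y :: "nat \<Rightarrow> 'a"
  assumes "lsc_efun b" "uniformly_continuous_on_bounded_convex grad U" "\<And>i. x i \<in> U" "\<And>i. y i \<in> U"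
    and "bounded (range x) \<or> bounded (range y)" "(\<lambda>i. norm (x i - y i)) \<longlonglongrightarrow> 0" "z \<in> D"
  shows "(\<lambda>i. bregman_div b z (x i) - bregman_div b z (y i)) \<longlonglongrightarrow> 0"
proof -
  have "bounded (range x \<union> range y)"
    using bounded_range_if_dist_tendsto_0[OF assms(6,5)] by simp
  then obtain R where R: "\<And>i. norm (x i) \<le> R" "\<And>i. norm (y i) \<le> R"
    unfolding bounded_iff by blast
  have bb: "bounded_on_bounded_convex grad U"
    using assms(2) by (rule uniformly_continuous_on_bounded_convex_imp_bounded)
  have dist': "(\<lambda>i. norm (y i - x i)) \<longlonglongrightarrow> 0"
    using assms(6) by (simp add: norm_minus_commute)
  have "(\<lambda>i. bregman_div b (y i) (x i)) \<longlonglongrightarrow> 0"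
    using assms(3-5) U_subset by (intro bregman_div_tendsto_0[OF assms(1) bb _ _ _ dist']) auto
  then have 1: "(\<lambda>i. bd (y i) (x i)) \<longlonglongrightarrow> 0"
    using assms(3,4) U_subset by (simp add: bregman_div_eq zero_ereal_def)
  have "convex (U \<inter> cball 0 R)" "bounded (U \<inter> cball 0 R)"
    using convex_dom by (auto intro!: convex_Int)
  then have "uniformly_continuous_on (U \<inter> cball 0 R) grad"
    using assms(2) unfolding uniformly_continuous_on_bounded_convex_def by blast
  then have "(\<lambda>i. dist (grad (y i)) (grad (x i))) \<longlonglongrightarrow> 0"
    using assms(3,4) R dist' unfolding uniformly_continuous_on_sequentially
    by (auto simp: dist_norm)
  then have grads: "(\<lambda>i. norm (grad (y i) - grad (x i)) * (norm z + R)) \<longlonglongrightarrow> 0"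
    by (intro tendsto_mult_left_zero) (simp add: dist_norm)
  have "(\<lambda>i. blinfun_apply (grad (y i) - grad (x i)) (z - y i)) \<longlonglongrightarrow> 0"
  proof (rule Lim_null_comparison[OF always_eventually grads], rule allI)
    fix i
    have "norm (blinfun_apply (grad (y i) - grad (x i)) (z - y i)) \<le> norm (grad (y i) - grad (x i)) * norm (z - y i)"
      by (rule norm_blinfun)
    also have "\<dots> \<le> norm (grad (y i) - grad (x i)) * (norm z + R)"
      using norm_triangle_ineq4[of z "y i"] R(2)[of i] by (intro mult_left_mono) auto
    finally show "norm (blinfun_apply (grad (y i) - grad (x i)) (z - y i)) \<le> norm (grad (y i) - grad (x i)) * (norm z + R)" .
  qed
  from tendsto_add[OF 1 this] have "(\<lambda>i. bd z (x i) - bd z (y i)) \<longlonglongrightarrow> 0"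
    by (simp add: three_point_identity)
  then show ?thesis
    using assms(3,4,7) by (simp add: bregman_div_eq zero_ereal_def)
qed

lemma bregman_div_diff_tendsto:
  fixes y :: "nat \<Rightarrow> 'a"
  assumes "\<And>i. y i \<in> U" "z \<in> U" "x \<in> D" "\<And>w. (\<lambda>i. grad (y i) w) \<longlonglongrightarrow> grad z w"
  shows "(\<lambda>i. bregman_div b x (y i) - bregman_div b z (y i)) \<longlonglongrightarrow> bregman_div b x z"
proof -
  have "bd x (y i) - bd z (y i) = f x - f z - grad (y i) (x - z)" for i
    by (simp add: bd_def blinfun.diff_right)
  moreover have "(\<lambda>i. f x - f z - grad (y i) (x - z)) \<longlonglongrightarrow> f x - f z - grad z (x - z)"
    by (rule tendsto_diff[OF tendsto_const assms(4)])
  ultimately have "(\<lambda>i. bd x (y i) - bd z (y i)) \<longlonglongrightarrow> bd x z"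
    by (simp add: bd_def[of x z])
  then show ?thesis
    using assms U_subset by (simp add: bregman_div_eq)
qed

end

section \<open>Convergence, boundedness and level sets of the divergence\<close>

theorem proposition4p13:
  fixes b :: "'a::real_normed_vector \<Rightarrow> ereal"
    and U S1 S2 :: "'a set"
    and B :: "'a \<Rightarrow> 'a \<Rightarrow> ereal"
    and b' :: "'a \<Rightarrow> ('a \<Rightarrow>\<^sub>L real)"
  assumes "\<exists>x::'a. x \<noteq> 0"
    and "convex_efun b"
    and "lsc_efun b"
    and "U = interior (edom b)"
    and "U \<noteq> {}"
    and "gateaux_differentiable_on b U"
    and "b' = gateaux_deriv b"
    and "B = bregman_div b"
    and "S1 \<noteq> {}" "S1 \<subseteq> edom b"
    and "S2 \<noteq> {}" "S2 \<subseteq> edom b"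
  shows
  "\<comment> \<open>(I)\<close>
   ((\<forall>x\<in>edom b. \<forall>y\<in>U.
       (\<forall>\<psi>. relative_gauge b {x} {y} \<psi> \<longrightarrow> \<psi> (norm (x - y)) \<le> B x y) \<and>
       (uniformly_convex_rel b {x} {y} \<longrightarrow>
          relative_gauge b {x} {y} (convexity_modulus b {x} {y}) \<and>
          convexity_modulus b {x} {y} (norm (x - y)) \<le> B x y)) \<and>
    (\<forall>\<psi>. S2 \<inter> U \<noteq> {} \<and> relative_gauge b S1 (S2 \<inter> U) \<psi> \<longrightarrow>
       (\<forall>x\<in>S1. \<forall>y\<in>S2 \<inter> U. \<psi> (norm (x - y)) \<le> B x y)) \<and>
    (\<forall>\<psi> J. S2 \<inter> U \<noteq> {} \<and> relative_gauge b S1 (S2 \<inter> U) \<psi> \<and>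
       is_interval J \<and> J \<subseteq> {0..} \<and> strict_mono_on J \<psi> \<and> continuous_on J \<psi> \<and>
       (\<forall>x\<in>S1. \<forall>y\<in>S2 \<inter> U. B x y \<in> \<psi> ` J) \<longrightarrow>
       (\<forall>x\<in>S1. \<forall>y\<in>S2 \<inter> U.
          strict_mono_on {0..} \<psi> \<or> (\<exists>s\<in>J. norm (x - y) \<le> s) \<longrightarrow>
          norm (x - y) \<le> the_inv_into J \<psi> (B x y)))) \<and>

   \<comment> \<open>(II)\<close>
   ((\<forall>y\<in>U. convex_efun (\<lambda>x. B x y) \<and> lsc_efun (\<lambda>x. B x y)) \<and>
    (\<forall>\<psi>. relative_gauge b S1 S2 \<psi> \<longrightarrow>
       (\<forall>y\<in>U. relative_gauge (\<lambda>x. B x y) S1 S2 \<psi>))) \<and>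

   \<comment> \<open>(III)\<close>
   ((\<forall>x y. x = y \<and> y \<in> U \<longrightarrow> B x y = 0) \<and>
    (\<forall>x y. 0 \<le> B x y) \<and>
    (\<forall>x\<in>edom b. \<forall>y\<in>U. x \<noteq> y \<and> strictly_convex_on (open_segment x y) b \<longrightarrow> 0 < B x y) \<and>
    (strictly_convex_on U b \<longrightarrow> (\<forall>x\<in>edom b. \<forall>y\<in>U. B x y = 0 \<longleftrightarrow> x = y))) \<and>

   \<comment> \<open>(IV)\<close>
   (\<forall>S (x::nat \<Rightarrow> 'a) (y::nat \<Rightarrow> 'a).
      S \<noteq> {} \<and> convex S \<and> S \<subseteq> edom b \<and> S \<inter> U \<noteq> {} \<and> uniformly_convex_on b S \<and>
      (\<forall>i. x i \<in> S) \<and> (\<forall>i. y i \<in> S \<inter> U) \<and> (\<lambda>i. B (x i) (y i)) \<longlonglongrightarrow> 0 \<longrightarrow>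
      (\<lambda>i. norm (x i - y i)) \<longlonglongrightarrow> 0) \<and>

   \<comment> \<open>(V)\<close>
   ((\<forall>S. S \<noteq> {} \<and> bounded S \<and> convex S \<and> S \<subseteq> edom b \<longrightarrow> uniformly_convex_on b S) \<longrightarrow>
      (\<forall>(x::nat \<Rightarrow> 'a) (y::nat \<Rightarrow> 'a).
         (\<forall>i. x i \<in> edom b) \<and> (\<forall>i. y i \<in> U) \<and> (\<lambda>i. B (x i) (y i)) \<longlonglongrightarrow> 0 \<and>
         (bounded (range x) \<or> bounded (range y)) \<longrightarrow>
         bounded (range x) \<and> bounded (range y) \<and> (\<lambda>i. norm (x i - y i)) \<longlonglongrightarrow> 0) \<and>
      sequentially_consistent b \<and>
      (\<forall>(x::nat \<Rightarrow> 'a) (y::nat \<Rightarrow> 'a). \<forall>z\<in>closure (edom b).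
         (\<forall>i. x i \<in> edom b) \<and> (\<forall>i. y i \<in> U) \<and> (\<lambda>i. B (x i) (y i)) \<longlonglongrightarrow> 0 \<and>
         (x \<longlonglongrightarrow> z \<or> y \<longlonglongrightarrow> z) \<longrightarrow>
         x \<longlonglongrightarrow> z \<and> y \<longlonglongrightarrow> z)) \<and>

   \<comment> \<open>(VI)\<close>
   (continuous_on (edom b) b \<and> strictly_convex_on U b \<and> continuous_on U b' \<longrightarrow>
      (\<forall>(x::nat \<Rightarrow> 'a) (y::nat \<Rightarrow> 'a). \<forall>z\<in>U.
         ((\<exists>K. compact K \<and> K \<subseteq> edom b \<and> range x \<subseteq> K) \<or>
          (fin_dim TYPE('a) \<and> (\<forall>i. x i \<in> edom b) \<and> bounded (range x))) \<and>
         (\<forall>i. y i \<in> U) \<and> (\<lambda>i. norm (y i - z)) \<longlonglongrightarrow> 0 \<and> (\<lambda>i. B (x i) (y i)) \<longlonglongrightarrow> 0 \<longrightarrow>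
         (\<lambda>i. norm (x i - z)) \<longlonglongrightarrow> 0)) \<and>

   \<comment> \<open>(VII)\<close>
   ((\<forall>(x::nat \<Rightarrow> 'a) (y::nat \<Rightarrow> 'a) K.
       (\<forall>i. x i \<in> edom b) \<and> bounded (range x) \<and> (\<forall>i. y i \<in> U) \<and>
       compact K \<and> K \<subseteq> closure (edom b) \<and> range y \<subseteq> K \<and>
       bregman_function b U \<and> (K \<subseteq> edom b \<or> bregman_limit_property b K) \<and>
       (\<lambda>i. B (x i) (y i)) \<longlonglongrightarrow> 0 \<longrightarrow>
       (\<lambda>i. norm (x i - y i)) \<longlonglongrightarrow> 0) \<and>
    (fin_dim TYPE('a) \<longrightarrow>
       (\<forall>y::nat \<Rightarrow> 'a. (\<forall>i. y i \<in> U) \<and> bounded (range y) \<longrightarrow>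
          (\<exists>K. compact K \<and> K \<subseteq> closure (edom b) \<and> range y \<subseteq> K)))) \<and>

   \<comment> \<open>(VIII)\<close>
   (bounded_on_bounded_convex b' U \<longrightarrow>
      (\<forall>(x::nat \<Rightarrow> 'a) (y::nat \<Rightarrow> 'a).
         (\<forall>i. x i \<in> U) \<and> (\<forall>i. y i \<in> U) \<and> (bounded (range x) \<or> bounded (range y)) \<and>
         (\<lambda>i. norm (x i - y i)) \<longlonglongrightarrow> 0 \<longrightarrow>
         (\<lambda>i. B (x i) (y i)) \<longlonglongrightarrow> 0)) \<and>

   \<comment> \<open>(IX)\<close>
   ((continuous_on (edom b) b \<and> bounded_on_bounded_convex b' U \<longrightarrow>
       (\<forall>(x::nat \<Rightarrow> 'a) (y::nat \<Rightarrow> 'a).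
          (\<forall>i. x i \<in> edom b) \<and> (\<forall>i. y i \<in> U) \<and> (bounded (range x) \<or> bounded (range y)) \<and>
          (\<lambda>i. norm (x i - y i)) \<longlonglongrightarrow> 0 \<longrightarrow>
          (\<lambda>i. B (x i) (y i)) \<longlonglongrightarrow> 0)) \<and>
    (continuous_on (edom b) b \<and> uniformly_continuous_on_bounded_convex b' U \<longrightarrow>
       (\<forall>y::nat \<Rightarrow> 'a. \<forall>x\<in>edom b. (\<forall>i. y i \<in> U) \<and> y \<longlonglongrightarrow> x \<longrightarrow>
          (\<lambda>i. B x (y i)) \<longlonglongrightarrow> 0))) \<and>

   \<comment> \<open>(X)\<close>
   ((continuous_on U b \<and> (\<forall>x\<in>U. locally_bounded_at b' U x) \<longrightarrow>
       (\<forall>y::nat \<Rightarrow> 'a. \<forall>x\<in>U. (\<forall>i. y i \<in> U) \<and> (\<lambda>i. norm (x - y i)) \<longlonglongrightarrow> 0 \<longrightarrow>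
          (\<lambda>i. B x (y i)) \<longlonglongrightarrow> 0)) \<and>
    (fin_dim TYPE('a) \<longrightarrow>
       (\<forall>y::nat \<Rightarrow> 'a. \<forall>x\<in>U. (\<forall>i. y i \<in> U) \<and> y \<longlonglongrightarrow> x \<longrightarrow>
          (\<lambda>i. B x (y i)) \<longlonglongrightarrow> 0))) \<and>

   \<comment> \<open>(XI)\<close>
   (continuous_on (edom b) b \<and>
    (\<forall>x\<in>edom b. \<forall>y::nat \<Rightarrow> 'a. (\<forall>i. y i \<in> U) \<and> y \<longlonglongrightarrow> x \<longrightarrow>
       (\<lambda>i. blinfun_apply (b' (y i)) (x - y i)) \<longlonglongrightarrow> 0) \<longrightarrow>
      (\<forall>y::nat \<Rightarrow> 'a. \<forall>x\<in>edom b. (\<forall>i. y i \<in> U) \<and> (\<lambda>i. norm (x - y i)) \<longlonglongrightarrow> 0 \<longrightarrow>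
         (\<lambda>i. B x (y i)) \<longlonglongrightarrow> 0)) \<and>

   \<comment> \<open>(XII)\<close>
   (\<forall>S x. S \<noteq> {} \<and> S \<subseteq> U \<and> x \<in> U \<and> (SUP y\<in>S. ereal (norm (x - y))) < \<infinity> \<and>
      bounded_on_bounded_convex b' U \<longrightarrow>
      (SUP y\<in>S. B x y) < \<infinity>) \<and>

   \<comment> \<open>(XIII)\<close>
   (\<forall>S x. S \<noteq> {} \<and> S \<subseteq> U \<and> x \<in> edom b \<and> (SUP y\<in>S. ereal (norm (x - y))) < \<infinity> \<and>
      continuous_on (edom b) b \<and> bounded_on_bounded_convex b' U \<longrightarrow>
      (SUP y\<in>S. B x y) < \<infinity>) \<and>

   \<comment> \<open>(XIV)\<close>
   ((\<forall>S S' S'' V x \<psi>.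
       S \<noteq> {} \<and> S \<subseteq> U \<and> x \<in> edom b \<and> S = S' \<union> S'' \<and> bounded S' \<and>
       S'' \<subseteq> V \<and> V \<noteq> {} \<and> V \<subseteq> U \<and>
       relative_gauge b {x} V \<psi> \<and> (\<psi> \<longlongrightarrow> \<infinity>) at_top \<and> (SUP y\<in>S. B x y) < \<infinity> \<longrightarrow>
       bounded S) \<and>
    (\<forall>S S' S'' W y \<psi>.
       S \<noteq> {} \<and> S \<subseteq> edom b \<and> y \<in> U \<and> S = S' \<union> S'' \<and> bounded S' \<and>
       S'' \<subseteq> W \<and> W \<noteq> {} \<and> W \<subseteq> edom b \<and>
       relative_gauge b W {y} \<psi> \<and> (\<psi> \<longlongrightarrow> \<infinity>) at_top \<and> (SUP x\<in>S. B x y) < \<infinity> \<longrightarrow>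
       bounded S)) \<and>

   \<comment> \<open>(XV)\<close>
   ((\<forall>(r::'a \<Rightarrow> real) (\<psi>::'a \<Rightarrow> real \<Rightarrow> ereal).
       (\<forall>x\<in>edom b. 0 \<le> r x \<and> U \<inter> {w. r x \<le> norm w} \<noteq> {} \<and>
          relative_gauge b {x} (U \<inter> {w. r x \<le> norm w}) (\<psi> x) \<and> (\<psi> x \<longlongrightarrow> \<infinity>) at_top) \<longrightarrow>
       (\<forall>x\<in>edom b. \<forall>\<gamma>\<ge>0.
          bounded (level1 b x \<gamma>) \<and>
          (\<psi> x 0 = 0 \<and> continuous_on {0..} (\<psi> x) \<and> strict_mono_on {0..} (\<psi> x) \<longrightarrow>
             diameter (level1 b x \<gamma>) \<le>
               Max {2 * the_inv_into {0..} (\<psi> x) (ereal \<gamma>), 2 * r x,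
                    the_inv_into {0..} (\<psi> x) (ereal \<gamma>) + r x + norm x}))) \<and>
    (\<forall>(r::'a \<Rightarrow> real) (\<psi>::'a \<Rightarrow> real \<Rightarrow> ereal).
       (\<forall>y\<in>U. 0 \<le> r y \<and> {w \<in> edom b. r y \<le> norm w} \<noteq> {} \<and>
          relative_gauge b {w \<in> edom b. r y \<le> norm w} {y} (\<psi> y) \<and> (\<psi> y \<longlongrightarrow> \<infinity>) at_top) \<longrightarrow>
       (\<forall>y\<in>edom b. \<forall>\<gamma>\<ge>0. bounded (level2 b y \<gamma>)) \<and>
       (\<forall>y\<in>U. \<forall>\<gamma>\<ge>0.
          \<psi> y 0 = 0 \<and> continuous_on {0..} (\<psi> y) \<and> strict_mono_on {0..} (\<psi> y) \<longrightarrow>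
            diameter (level2 b y \<gamma>) \<le>
              Max {2 * the_inv_into {0..} (\<psi> y) (ereal \<gamma>), 2 * r y,
                   the_inv_into {0..} (\<psi> y) (ereal \<gamma>) + r y + norm y})) \<and>
    (uniformly_convex_on b (edom b) \<longrightarrow>
       (\<forall>x\<in>edom b. \<forall>\<gamma>\<ge>0. bounded (level1 b x \<gamma>)) \<and>
       (\<forall>y\<in>edom b. \<forall>\<gamma>\<ge>0. bounded (level2 b y \<gamma>)))) \<and>

   \<comment> \<open>(XVI)\<close>
   ((bounded U \<longrightarrow> (\<forall>x\<in>edom b. \<forall>\<gamma>\<ge>0. bounded (level1 b x \<gamma>))) \<and>
    (\<not> bounded U \<and>
     (\<forall>x\<in>edom b. ((\<lambda>y. B x y) \<longlongrightarrow> \<infinity>) (inf at_infinity (principal U))) \<longrightarrow>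
       (\<forall>x\<in>edom b. \<forall>\<gamma>\<ge>0. bounded (level1 b x \<gamma>)))) \<and>

   \<comment> \<open>(XVII)\<close>
   ((bounded U \<longrightarrow> (\<forall>y\<in>U. \<forall>\<gamma>\<ge>0. bounded (level2 b y \<gamma>))) \<and>
    (\<not> bounded U \<and>
     (\<forall>y\<in>U. ((\<lambda>x. B x y) \<longlongrightarrow> \<infinity>) (inf at_infinity (principal (edom b)))) \<longrightarrow>
       (\<forall>y\<in>U. \<forall>\<gamma>\<ge>0. bounded (level2 b y \<gamma>))) \<and>
    (fin_dim TYPE('a) \<and> strictly_convex_on U b \<and> essentially_smooth b \<longrightarrow>
       (\<forall>y\<in>U. \<forall>\<gamma>\<ge>0. bounded (level2 b y \<gamma>))) \<and>
    (fin_dim TYPE('a) \<and> strictly_convex_on (edom b) b \<longrightarrow>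
       (\<forall>y\<in>U. \<forall>\<gamma>\<ge>0. bounded (level2 b y \<gamma>)))) \<and>

   \<comment> \<open>(XVIII)\<close>
   (uniformly_continuous_on_bounded_convex b' U \<longrightarrow>
      (\<forall>(x::nat \<Rightarrow> 'a) (y::nat \<Rightarrow> 'a).
         (\<forall>i. x i \<in> U) \<and> (\<forall>i. y i \<in> U) \<and> (bounded (range x) \<or> bounded (range y)) \<and>
         (\<lambda>i. norm (x i - y i)) \<longlonglongrightarrow> 0 \<longrightarrow>
         (\<forall>z\<in>edom b. (\<lambda>i. B z (x i) - B z (y i)) \<longlonglongrightarrow> 0))) \<and>

   \<comment> \<open>(XIX)\<close>
   ((weak_to_weakstar_seq_continuous_on U b' \<longrightarrow>
       (\<forall>y::nat \<Rightarrow> 'a. \<forall>z\<in>U. (\<forall>i. y i \<in> U) \<and> weakly_converges y z \<longrightarrow>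
          (\<forall>x\<in>edom b. (\<lambda>i. B x (y i) - B z (y i)) \<longlonglongrightarrow> B x z))) \<and>
    (fin_dim TYPE('a) \<and> continuous_on U b' \<longrightarrow>
       (\<forall>y::nat \<Rightarrow> 'a. \<forall>z\<in>U. (\<forall>i. y i \<in> U) \<and> y \<longlonglongrightarrow> z \<longrightarrow>
          (\<forall>x\<in>edom b. (\<lambda>i. B x (y i) - B z (y i)) \<longlonglongrightarrow> B x z)))) \<and>

   \<comment> \<open>(XX)\<close>
   ((\<forall>x\<in>edom b. \<forall>\<psi> (y::nat \<Rightarrow> 'a).
       relative_gauge b {x} (S2 \<inter> U) \<psi> \<and> continuous_on {0..} \<psi> \<and> strict_mono_on {0..} \<psi> \<and>
       (\<psi> \<longlongrightarrow> \<infinity>) at_top \<and> \<psi> 0 = 0 \<and>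
       (\<forall>i. y i \<in> S2 \<inter> U) \<and> (\<lambda>i. B x (y i)) \<longlonglongrightarrow> 0 \<longrightarrow>
       y \<longlonglongrightarrow> x) \<and>
    (\<forall>y\<in>U. \<forall>\<psi> (x::nat \<Rightarrow> 'a).
       relative_gauge b S1 {y} \<psi> \<and> continuous_on {0..} \<psi> \<and> strict_mono_on {0..} \<psi> \<and>
       (\<psi> \<longlongrightarrow> \<infinity>) at_top \<and> \<psi> 0 = 0 \<and>
       (\<forall>i. x i \<in> S1) \<and> (\<lambda>i. B (x i) y) \<longlonglongrightarrow> 0 \<longrightarrow>
       x \<longlonglongrightarrow> y))"
proof -
  note U_def = assms(4) and b'_def = assms(7) and B_def = assms(8) and lsc = assms(3)
  let ?U = "interior (edom b)"
  interpret gateaux_convex b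
    using assms(2,4,6) by unfold_locales simp_all
  have bdd_restrict: "bounded S" if "S = S' \<union> S''" "bounded S'" "\<And>u. u \<in> S'' \<Longrightarrow> norm (x - u) \<le> R"
    for S S' S'' :: "'a set" and x R
  proof -
    have "bounded S''"
      using that(3) unfolding bounded_def by (intro exI[of _ x] exI[of _ R]) (simp add: dist_norm)
    then show ?thesis using that(1,2) by simp
  qed
  have bdd_centre: "bounded S" if "\<And>u. u \<in> S \<Longrightarrow> norm (x - u) \<le> R" for S :: "'a set" and x R
    using bdd_restrict[of S "{}" S x R] that by simp
  have bdd_norm: "bounded S" if "\<And>u. u \<in> S \<Longrightarrow> norm (u - x) \<le> R" for S :: "'a set" and x R
    using bdd_centre[of S x R] that by (simp add: norm_minus_commute)
  have far: "bounded S" if "\<And>u. u \<in> S \<Longrightarrow> r \<le> norm u \<Longrightarrow> norm (x - u) \<le> R" for S :: "'a set" and x r R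
  proof -
    have "norm u \<le> max r (norm x + R)" if "u \<in> S" for u
      using \<open>\<And>u. u \<in> S \<Longrightarrow> r \<le> norm u \<Longrightarrow> norm (x - u) \<le> R\<close>[OF that] norm_triangle_ineq2[of u x]
      by (cases "r \<le> norm u") (auto simp: norm_minus_commute)
    then show ?thesis unfolding bounded_iff by blast
  qed
  show ?thesis
    unfolding U_def b'_def B_def
  proof (intro conjI, goal_cases)
    \<comment> \<open>Gauge of a single pair, and the modulus as such a gauge\<close>
    case 1
    then show ?case
      using gauge_le_bregman_div relative_gauge_convexity_modulus
      unfolding uniformly_convex_rel_def by (meson singletonI)
  next
    \<comment> \<open>Gauge bound on sets\<close>
    case 2
    then show ?case using gauge_le_bregman_div by blast
  next
    \<comment> \<open>Inversion of a gauge\<close>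
    case 3
    show ?case
    proof (intro allI impI ballI, elim conjE, goal_cases)
      case (1 \<psi> J x y)
      then show ?case
        by (intro norm_le_gauge_inverse[of S1 "S2 \<inter> ?U" \<psi>]) auto
    qed
  next
    \<comment> \<open>Convexity and lower semicontinuity in the first argument\<close>
    case 4
    then show ?case using convex_efun_bregman_div lsc_efun_bregman_div[OF lsc] by blast
  next
    \<comment> \<open>The divergence inherits gauges\<close>
    case 5
    then show ?case using relative_gauge_bregman_div by blast
  next
    \<comment> \<open>The diagonal\<close>
    case 6
    then show ?case using bregman_div_eq U_subset by (auto simp: zero_ereal_def)
  next
    \<comment> \<open>Nonnegativity\<close>
    case 7
    then show ?case using bregman_div_nonneg by blast
  next
    \<comment> \<open>Positivity under strict convexity on the segment\<close>
    case 8
    then show ?case using bd_pos by (simp add: bregman_div_eq)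
  next
    \<comment> \<open>Zeros of the divergence\<close>
    case 9
    show ?case
    proof (intro impI ballI iffI)
      fix x y assume *: "strictly_convex_on ?U b" "x \<in> D" "y \<in> ?U" "bregman_div b x y = 0"
      then show "x = y"
        using bd_pos_strictly_convex[of x y] bregman_div_eq[of x y] by (cases "x = y") auto
    next
      fix x y assume "x \<in> D" "y \<in> ?U" "x = y"
      then show "bregman_div b x y = 0" by (simp add: bregman_div_eq zero_ereal_def)
    qed
  next
    \<comment> \<open>Small divergence on a convex set of uniform convexity\<close>
    case 10
    show ?case
    proof (intro allI impI, elim conjE)
      fix S x y
      assume S: "convex S" "S \<subseteq> D" "uniformly_convex_on b S" "\<forall>i. x i \<in> S" "\<forall>i. y i \<in> S \<inter> ?U"
        and lim: "(\<lambda>i::nat. bregman_div b (x i) (y i)) \<longlonglongrightarrow> 0"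
      show "(\<lambda>i. norm (x i - y i)) \<longlonglongrightarrow> 0"
      proof (rule tendsto_0_if_minorized[OF lim])
        fix \<epsilon> :: real assume "0 < \<epsilon>"
        then obtain c where c: "0 < c"
          "\<And>x y. \<lbrakk>x \<in> S; y \<in> S; y \<in> ?U; \<epsilon> \<le> norm (x - y)\<rbrakk> \<Longrightarrow> c * norm (x - y) \<le> bd x y"
          using uniformly_convex_growth[OF S(3,1)] by blast
        have "ereal (c * \<epsilon>) \<le> bregman_div b (x i) (y i)" if "\<epsilon> \<le> norm (x i - y i)" for i
        proof -
          have "c * \<epsilon> \<le> c * norm (x i - y i)" using c(1) that by simp
          also have "\<dots> \<le> bd (x i) (y i)" using S that by (intro c(2)) auto
          finally show ?thesis using S by (auto simp: bregman_div_eq subset_iff)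
        qed
        then show "\<exists>c>0. \<forall>i. \<epsilon> \<le> norm (x i - y i) \<longrightarrow> c \<le> bregman_div b (x i) (y i)"
          using c(1) \<open>0 < \<epsilon>\<close> by (intro exI[of _ "ereal (c * \<epsilon>)"]) simp
      qed simp
    qed
  next
    \<comment> \<open>Small divergence under uniform convexity on bounded convex sets\<close>
    case 11
    show ?case
    proof (rule impI)
      assume "\<forall>S. S \<noteq> {} \<and> bounded S \<and> convex S \<and> S \<subseteq> D \<longrightarrow> uniformly_convex_on b S"
      then have dist: "(\<lambda>i. norm (x i - y i)) \<longlonglongrightarrow> 0"
        if "\<And>i. x i \<in> D" "\<And>i. y i \<in> ?U" "(\<lambda>i. bregman_div b (x i) (y i)) \<longlonglongrightarrow> 0"
          "bounded (range x) \<or> bounded (range y)" for x y :: "nat \<Rightarrow> 'a"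
        using that by (intro uniformly_convex_on_bounded_imp_dist_tendsto_0) auto
      have both: "x \<longlonglongrightarrow> z \<and> y \<longlonglongrightarrow> z"
        if *: "\<And>i. x i \<in> D" "\<And>i. y i \<in> ?U" "(\<lambda>i. bregman_div b (x i) (y i)) \<longlonglongrightarrow> 0"
          "x \<longlonglongrightarrow> z \<or> y \<longlonglongrightarrow> z" for x y :: "nat \<Rightarrow> 'a" and z
      proof -
        have "bounded (range x) \<or> bounded (range y)"
          using *(4) convergent_imp_bounded by blast
        then have "(\<lambda>i. x i - y i) \<longlonglongrightarrow> 0"
          using dist[OF *(1-3)] by (simp add: tendsto_norm_zero_iff)
        then show ?thesis
          using *(4) tendsto_add[of "\<lambda>i. x i - y i" 0 _ y z] tendsto_diff[of x z _ "\<lambda>i. x i - y i" 0] by auto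
      qed
      show "(\<forall>(x::nat \<Rightarrow> 'a) (y::nat \<Rightarrow> 'a).
         (\<forall>i. x i \<in> D) \<and> (\<forall>i. y i \<in> ?U) \<and> (\<lambda>i. bregman_div b (x i) (y i)) \<longlonglongrightarrow> 0 \<and>
         (bounded (range x) \<or> bounded (range y)) \<longrightarrow>
         bounded (range x) \<and> bounded (range y) \<and> (\<lambda>i. norm (x i - y i)) \<longlonglongrightarrow> 0) \<and>
        sequentially_consistent b \<and>
        (\<forall>(x::nat \<Rightarrow> 'a) (y::nat \<Rightarrow> 'a). \<forall>z\<in>closure D.
         (\<forall>i. x i \<in> D) \<and> (\<forall>i. y i \<in> ?U) \<and> (\<lambda>i. bregman_div b (x i) (y i)) \<longlonglongrightarrow> 0 \<and>
         (x \<longlonglongrightarrow> z \<or> y \<longlonglongrightarrow> z) \<longrightarrow> x \<longlonglongrightarrow> z \<and> y \<longlonglongrightarrow> z)"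
      proof (intro conjI allI impI ballI)
        show "sequentially_consistent b"
          unfolding sequentially_consistent_def using dist by blast
        fix x y :: "nat \<Rightarrow> 'a"
        assume *: "(\<forall>i. x i \<in> D) \<and> (\<forall>i. y i \<in> ?U) \<and> (\<lambda>i. bregman_div b (x i) (y i)) \<longlonglongrightarrow> 0 \<and>
          (bounded (range x) \<or> bounded (range y))"
        then show lim: "(\<lambda>i. norm (x i - y i)) \<longlonglongrightarrow> 0" using dist by blast
        show "bounded (range x)" "bounded (range y)"
          using bounded_range_if_dist_tendsto_0[OF lim] * by blast+
      qed (use both in blast)+
    qed
  next
    \<comment> \<open>Small divergence with first arguments in a compact set\<close>
    case 12
    show ?case
    proof (intro allI ballI impI, elim conjE)
      fix x y :: "nat \<Rightarrow> 'a" and z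
      assume *: "continuous_on D b" "strictly_convex_on ?U b" "continuous_on ?U grad" "z \<in> ?U"
        and x: "(\<exists>K. compact K \<and> K \<subseteq> D \<and> range x \<subseteq> K) \<or>
          (fin_dim TYPE('a) \<and> (\<forall>i. x i \<in> D) \<and> bounded (range x))"
        and y: "\<forall>i. y i \<in> ?U" "(\<lambda>i. norm (y i - z)) \<longlonglongrightarrow> 0"
        and lim: "(\<lambda>i. bregman_div b (x i) (y i)) \<longlonglongrightarrow> 0"
      have xD: "\<And>i. x i \<in> D" using x by blast
      have yz: "y \<longlonglongrightarrow> z" using y(2) by (simp add: tendsto_norm_zero_iff LIM_zero_iff)
      have "(\<lambda>i. b (y i)) \<longlonglongrightarrow> b z"
        using y(1) *(4) U_subset by (intro continuous_on_tendsto_compose[OF *(1) yz]) auto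
      then have fy: "(\<lambda>i. f (y i)) \<longlonglongrightarrow> f z"
        using y(1) *(4) U_subset by (simp add: b_eq)
      have gy: "(\<lambda>i. grad (y i)) \<longlonglongrightarrow> grad z"
        using y(1) *(4) by (intro continuous_on_tendsto_compose[OF *(3) yz]) auto
      have lim': "(\<lambda>i. bd (x i) (y i)) \<longlonglongrightarrow> 0"
        using lim xD y(1) by (simp add: bregman_div_eq zero_ereal_def)
      have sub: "\<exists>s l. strict_mono s \<and> (\<lambda>i. x (r (s i))) \<longlonglongrightarrow> l" for r :: "nat \<Rightarrow> nat"
        using x
      proof (elim disjE exE conjE)
        fix K assume "compact K" "range x \<subseteq> K"
        moreover have "\<forall>i. (x \<circ> r) i \<in> K" using \<open>range x \<subseteq> K\<close> by auto
        ultimately obtain l s where "strict_mono s" "((x \<circ> r) \<circ> s) \<longlonglongrightarrow> l"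
          unfolding compact_def by blast
        then show ?thesis unfolding comp_def by blast
      next
        assume fin: "fin_dim TYPE('a)" and "bounded (range x)"
        then have "bounded (range (x \<circ> r))" by (auto intro: bounded_subset)
        then obtain l s where "strict_mono s" "((x \<circ> r) \<circ> s) \<longlonglongrightarrow> l"
          by (rule fin_dim_bounded_subsequence[OF fin])
        then show ?thesis unfolding comp_def by blast
      qed
      have "x \<longlonglongrightarrow> z"
      proof (rule bd_tendsto_0_imp_tendsto[where x = x and y = y and z = z])
        show "\<exists>s l. strict_mono s \<and> (\<lambda>i. x (r (s i))) \<longlonglongrightarrow> l" for r :: "nat \<Rightarrow> nat"
          by (rule sub)
      qed (rule lsc * xD y(1)[rule_format] yz fy gy lim')+
      then show "(\<lambda>i. norm (x i - z)) \<longlonglongrightarrow> 0" by (simp add: tendsto_norm_zero_iff LIM_zero_iff)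
    qed
  next
    \<comment> \<open>Small divergence of a Bregman function, second arguments in a compact set\<close>
    case 13
    show ?case
    proof (intro allI impI, elim conjE)
      fix x y :: "nat \<Rightarrow> 'a" and K
      assume x: "\<forall>i. x i \<in> D" "bounded (range x)" and y: "\<forall>i. y i \<in> ?U" and K: "compact K" "range y \<subseteq> K"
        and breg: "bregman_function b ?U" "K \<subseteq> D \<or> bregman_limit_property b K"
        and lim: "(\<lambda>i. bregman_div b (x i) (y i)) \<longlonglongrightarrow> 0"
      have limit_prop: "bregman_limit_property b K"
        using breg unfolding bregman_function_def bregman_limit_property_def by blast
      show "(\<lambda>i. norm (x i - y i)) \<longlonglongrightarrow> 0"
      proof (rule LIMSEQ_if_subsequences)
        fix r :: "nat \<Rightarrow> nat" assume r: "strict_mono r"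
        have "\<forall>i. (y \<circ> r) i \<in> K" using K(2) by auto
        then obtain l s where s: "l \<in> K" "strict_mono s" "((y \<circ> r) \<circ> s) \<longlonglongrightarrow> l"
          using K(1) unfolding compact_def by blast
        have rs: "strict_mono (\<lambda>i. r (s i))"
          using r s(2) by (simp add: strict_mono_def)
        have yl: "(\<lambda>i. norm (y (r (s i)) - l)) \<longlonglongrightarrow> 0"
          using s(3) by (simp add: tendsto_norm_zero_iff LIM_zero_iff o_def)
        moreover have "(\<lambda>i. bregman_div b (x (r (s i))) (y (r (s i)))) \<longlonglongrightarrow> 0"
          using LIMSEQ_subseq_LIMSEQ[OF lim rs] by (simp add: o_def)
        moreover have "bounded (range (\<lambda>i. x (r (s i))))"
          using x(2) by (rule bounded_subset) auto
        ultimately have "(\<lambda>i. norm (x (r (s i)) - l)) \<longlonglongrightarrow> 0"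
          using x(1) y by (intro limit_prop[unfolded bregman_limit_property_def, rule_format, OF s(1)]) auto
        with yl have "(\<lambda>i. x (r (s i)) - y (r (s i))) \<longlonglongrightarrow> l - l"
          by (intro tendsto_diff) (simp_all add: tendsto_norm_zero_iff LIM_zero_iff)
        then show "\<exists>s. strict_mono s \<and> (\<lambda>i. norm (x (r (s i)) - y (r (s i)))) \<longlonglongrightarrow> 0"
          using s(2) by (intro exI[of _ s]) (simp add: tendsto_norm_zero_iff)
      qed
    qed
  next
    \<comment> \<open>Bounded sequences of a finite-dimensional space lie in compact sets\<close>
    case 14
    show ?case
    proof (intro allI impI, elim conjE)
      fix y :: "nat \<Rightarrow> 'a"
      assume *: "fin_dim TYPE('a)" "\<forall>i. y i \<in> ?U" "bounded (range y)"
      have "compact (closure (range y))"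
        using * by (intro fin_dim_compact) auto
      moreover have "closure (range y) \<subseteq> closure D"
        using *(2) U_subset by (intro closure_mono) auto
      ultimately show "\<exists>K. compact K \<and> K \<subseteq> closure D \<and> range y \<subseteq> K"
        by (intro exI[of _ "closure (range y)"] conjI closure_subset)
    qed
  next
    \<comment> \<open>Close interior points\<close>
    case 15
    then show ?case using bregman_div_tendsto_0[OF lsc] U_subset by blast
  next
    \<comment> \<open>Close points, the first one possibly on the boundary\<close>
    case 16
    then show ?case using bregman_div_tendsto_0[OF lsc] by blast
  next
    \<comment> \<open>Convergence of the second argument, uniformly continuous derivative\<close>
    case 17
    show ?case
    proof (intro allI ballI impI, elim conjE)
      fix y :: "nat \<Rightarrow> 'a" and x
      assume *: "uniformly_continuous_on_bounded_convex grad ?U" "x \<in> D" "\<forall>i. y i \<in> ?U" "y \<longlonglongrightarrow> x"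
      have "(\<lambda>i. x - y i) \<longlonglongrightarrow> x - x"
        using *(4) by (intro tendsto_intros)
      then have "(\<lambda>i. norm (x - y i)) \<longlonglongrightarrow> 0"
        by (simp add: tendsto_norm_zero_iff)
      then show "(\<lambda>i. bregman_div b x (y i)) \<longlonglongrightarrow> 0"
        using * by (intro bregman_div_tendsto_0[OF lsc uniformly_continuous_on_bounded_convex_imp_bounded]) auto
    qed
  next
    \<comment> \<open>Convergence to an interior point, locally bounded derivative\<close>
    case 18
    then show ?case using bregman_div_tendsto_0_locally_bounded[OF lsc] by blast
  next
    \<comment> \<open>Convergence to an interior point in finite dimension\<close>
    case 19
    show ?case
    proof (intro allI ballI impI, elim conjE)
      fix y :: "nat \<Rightarrow> 'a" and x
      assume *: "fin_dim TYPE('a)" "x \<in> ?U" "\<forall>i. y i \<in> ?U" "y \<longlonglongrightarrow> x"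
      have "(\<lambda>i. x - y i) \<longlonglongrightarrow> x - x"
        using *(4) by (intro tendsto_intros)
      then have "(\<lambda>i. norm (x - y i)) \<longlonglongrightarrow> 0"
        by (simp add: tendsto_norm_zero_iff)
      then show "(\<lambda>i. bregman_div b x (y i)) \<longlonglongrightarrow> 0"
        using * fin_dim_locally_bounded_grad by (intro bregman_div_tendsto_0_locally_bounded[OF lsc]) auto
    qed
  next
    \<comment> \<open>Convergence when the derivative term vanishes\<close>
    case 20
    show ?case
    proof (intro allI ballI impI, elim conjE)
      fix y :: "nat \<Rightarrow> 'a" and x
      assume *: "continuous_on D b"
        "\<forall>x\<in>D. \<forall>y. (\<forall>i. y i \<in> ?U) \<and> y \<longlonglongrightarrow> x \<longrightarrow> (\<lambda>i. grad (y i) (x - y i)) \<longlonglongrightarrow> 0"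
        "x \<in> D" "\<forall>i. y i \<in> ?U" "(\<lambda>i. norm (x - y i)) \<longlonglongrightarrow> 0"
      have yx: "y \<longlonglongrightarrow> x"
        using *(5) by (simp add: tendsto_norm_zero_iff LIM_zero_iff norm_minus_commute[of x])
      have "(\<lambda>i. b (y i)) \<longlonglongrightarrow> b x"
        using *(3,4) U_subset by (intro continuous_on_tendsto_compose[OF *(1) yx]) auto
      then have "(\<lambda>i. f (y i)) \<longlonglongrightarrow> f x"
        using *(3,4) U_subset by (simp add: b_eq)
      then have "(\<lambda>i. bd x (y i)) \<longlonglongrightarrow> f x - f x - 0"
        unfolding bd_def using * yx by (intro tendsto_intros) auto
      then show "(\<lambda>i. bregman_div b x (y i)) \<longlonglongrightarrow> 0"
        using *(3,4) by (simp add: bregman_div_eq zero_ereal_def)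
    qed
  next
    \<comment> \<open>Bounded divergence from an interior point\<close>
    case 21
    then show ?case
      using SUP_bregman_div_less_infty[OF lsc] bounded_if_SUP_norm U_subset by metis
  next
    \<comment> \<open>Bounded divergence from a point of the domain\<close>
    case 22
    then show ?case
      using SUP_bregman_div_less_infty[OF lsc] bounded_if_SUP_norm by metis
  next
    \<comment> \<open>Coercive gauge, second argument varies\<close>
    case 23
    show ?case
    proof (intro allI impI, elim conjE)
      fix S S' S'' V x \<psi>
      assume S: "S \<subseteq> ?U" "S = S' \<union> S''" "bounded S'" "S'' \<subseteq> V"
        and \<psi>: "relative_gauge b {x} V \<psi>" "(\<psi> \<longlongrightarrow> \<infinity>) at_top"
        and sup: "(SUP y\<in>S. bregman_div b x y) < \<infinity>"
      obtain K where K: "\<And>y. y \<in> S \<Longrightarrow> bregman_div b x y \<le> ereal K"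
        using SUP_less_infty_obtain[OF sup] by blast
      obtain R where R: "\<And>z y. \<lbrakk>z \<in> {x}; y \<in> V; y \<in> ?U; bregman_div b z y \<le> ereal K\<rbrakk> \<Longrightarrow> norm (z - y) \<le> R"
        using coercive_gauge_imp_norm_bounded[OF \<psi>] by blast
      show "bounded S"
      proof (rule bdd_restrict[OF S(2,3)])
        show "norm (x - u) \<le> R" if "u \<in> S''" for u
          using that S by (intro R K) auto
      qed
    qed
  next
    \<comment> \<open>Coercive gauge, first argument varies\<close>
    case 24
    show ?case
    proof (intro allI impI, elim conjE)
      fix S S' S'' W y \<psi>
      assume S: "S = S' \<union> S''" "bounded S'" "S'' \<subseteq> W" "y \<in> ?U"
        and \<psi>: "relative_gauge b W {y} \<psi>" "(\<psi> \<longlongrightarrow> \<infinity>) at_top"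
        and sup: "(SUP x\<in>S. bregman_div b x y) < \<infinity>"
      obtain K where K: "\<And>x. x \<in> S \<Longrightarrow> bregman_div b x y \<le> ereal K"
        using SUP_less_infty_obtain[OF sup] by blast
      obtain R where R: "\<And>x z. \<lbrakk>x \<in> W; z \<in> {y}; z \<in> ?U; bregman_div b x z \<le> ereal K\<rbrakk> \<Longrightarrow> norm (x - z) \<le> R"
        using coercive_gauge_imp_norm_bounded[OF \<psi>] by blast
      show "bounded S"
      proof (rule bdd_restrict[OF S(1,2)])
        show "norm (y - u) \<le> R" if "u \<in> S''" for u
          unfolding norm_minus_commute[of y] using that S by (intro R K) auto
      qed
    qed
  next
    \<comment> \<open>First type level sets with coercive gauges\<close>
    case 25
    show ?case
    proof (intro allI ballI impI)
      fix r :: "'a \<Rightarrow> real" and \<psi> :: "'a \<Rightarrow> real \<Rightarrow> ereal" and x and \<gamma> :: real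
      assume H: "\<forall>x\<in>D. 0 \<le> r x \<and> ?U \<inter> {w. r x \<le> norm w} \<noteq> {} \<and>
          relative_gauge b {x} (?U \<inter> {w. r x \<le> norm w}) (\<psi> x) \<and> (\<psi> x \<longlongrightarrow> \<infinity>) at_top"
        and x: "x \<in> D" and \<gamma>: "0 \<le> \<gamma>"
      have r: "0 \<le> r x" and \<psi>: "relative_gauge b {x} (?U \<inter> {w. r x \<le> norm w}) (\<psi> x)" "(\<psi> x \<longlongrightarrow> \<infinity>) at_top"
        using H x by auto
      obtain R where "\<And>z y. \<lbrakk>z \<in> {x}; y \<in> ?U \<inter> {w. r x \<le> norm w}; y \<in> ?U; bregman_div b z y \<le> ereal \<gamma>\<rbrakk>
          \<Longrightarrow> norm (z - y) \<le> R"
        using coercive_gauge_imp_norm_bounded[OF \<psi>] by blast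
      then have "bounded (level1 b x \<gamma>)"
        by (intro far[of _ "r x" x R]) (auto simp: level1_def)
      moreover have "diameter (level1 b x \<gamma>) \<le>
          Max {2 * the_inv_into {0..} (\<psi> x) (ereal \<gamma>), 2 * r x, the_inv_into {0..} (\<psi> x) (ereal \<gamma>) + r x + norm x}"
        if "\<psi> x 0 = 0 \<and> continuous_on {0..} (\<psi> x) \<and> strict_mono_on {0..} (\<psi> x)"
        using that \<gamma> \<psi>(2) by (intro diameter_le_of_far_points[OF r] norm_le_coercive_gauge_inverse[OF \<psi>(1)])
          (auto simp: level1_def)
      ultimately show "bounded (level1 b x \<gamma>) \<and>
          (\<psi> x 0 = 0 \<and> continuous_on {0..} (\<psi> x) \<and> strict_mono_on {0..} (\<psi> x) \<longrightarrow>
             diameter (level1 b x \<gamma>) \<le>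
               Max {2 * the_inv_into {0..} (\<psi> x) (ereal \<gamma>), 2 * r x,
                    the_inv_into {0..} (\<psi> x) (ereal \<gamma>) + r x + norm x})"
        by blast
    qed
  next
    \<comment> \<open>Second type level sets with coercive gauges\<close>
    case 26
    show ?case
    proof (intro allI impI)
      fix r :: "'a \<Rightarrow> real" and \<psi> :: "'a \<Rightarrow> real \<Rightarrow> ereal"
      assume H: "\<forall>y\<in>?U. 0 \<le> r y \<and> {w \<in> D. r y \<le> norm w} \<noteq> {} \<and>
          relative_gauge b {w \<in> D. r y \<le> norm w} {y} (\<psi> y) \<and> (\<psi> y \<longlongrightarrow> \<infinity>) at_top"
      have "bounded (level2 b y \<gamma>)" for y \<gamma>
      proof (cases "y \<in> ?U")
        case True
        then have \<psi>: "relative_gauge b {w \<in> D. r y \<le> norm w} {y} (\<psi> y)" "(\<psi> y \<longlongrightarrow> \<infinity>) at_top"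
          using H by auto
        obtain R where "\<And>x z. \<lbrakk>x \<in> {w \<in> D. r y \<le> norm w}; z \<in> {y}; z \<in> ?U; bregman_div b x z \<le> ereal \<gamma>\<rbrakk>
            \<Longrightarrow> norm (x - z) \<le> R"
          using coercive_gauge_imp_norm_bounded[OF \<psi>] by blast
        then show ?thesis
          using True by (intro far[of _ "r y" y R]) (auto simp: level2_def norm_minus_commute[of y])
      next
        case False
        then have "level2 b y \<gamma> = {}" by (auto simp: level2_def bregman_div_def)
        then show ?thesis by simp
      qed
      moreover have "diameter (level2 b y \<gamma>) \<le>
          Max {2 * the_inv_into {0..} (\<psi> y) (ereal \<gamma>), 2 * r y, the_inv_into {0..} (\<psi> y) (ereal \<gamma>) + r y + norm y}"
        if y: "y \<in> ?U" and "0 \<le> \<gamma>"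
          and inv: "\<psi> y 0 = 0 \<and> continuous_on {0..} (\<psi> y) \<and> strict_mono_on {0..} (\<psi> y)" for y \<gamma>
      proof (rule diameter_le_of_far_points)
        show "0 \<le> r y" using H y by blast
        fix x assume "x \<in> level2 b y \<gamma>" "r y \<le> norm x"
        then have "norm (x - y) \<le> the_inv_into {0..} (\<psi> y) (ereal \<gamma>)"
          using H y inv \<open>0 \<le> \<gamma>\<close>
          by (intro norm_le_coercive_gauge_inverse[of "{w \<in> D. r y \<le> norm w}" "{y}"]) (auto simp: level2_def)
        then show "norm (y - x) \<le> the_inv_into {0..} (\<psi> y) (ereal \<gamma>)"
          by (simp add: norm_minus_commute)
      qed
      ultimately show "(\<forall>y\<in>D. \<forall>\<gamma>\<ge>0. bounded (level2 b y \<gamma>)) \<and>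
       (\<forall>y\<in>?U. \<forall>\<gamma>\<ge>0.
          \<psi> y 0 = 0 \<and> continuous_on {0..} (\<psi> y) \<and> strict_mono_on {0..} (\<psi> y) \<longrightarrow>
            diameter (level2 b y \<gamma>) \<le>
              Max {2 * the_inv_into {0..} (\<psi> y) (ereal \<gamma>), 2 * r y,
                   the_inv_into {0..} (\<psi> y) (ereal \<gamma>) + r y + norm y})"
        by blast
    qed
  next
    \<comment> \<open>Level sets under uniform convexity\<close>
    case 27
    show ?case
    proof (intro impI conjI ballI allI)
      fix x and \<gamma> :: real assume "uniformly_convex_on b D" "x \<in> D"
      then obtain R where "\<And>x y. \<lbrakk>x \<in> D; y \<in> ?U; bregman_div b x y \<le> ereal \<gamma>\<rbrakk> \<Longrightarrow> norm (x - y) \<le> R"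
        using uniformly_convex_imp_norm_bounded by blast
      then show "bounded (level1 b x \<gamma>)"
        using \<open>x \<in> D\<close> by (intro bdd_centre[of _ x R]) (auto simp: level1_def)
    next
      fix y and \<gamma> :: real assume "uniformly_convex_on b D"
      then obtain R where "\<And>x y. \<lbrakk>x \<in> D; y \<in> ?U; bregman_div b x y \<le> ereal \<gamma>\<rbrakk> \<Longrightarrow> norm (x - y) \<le> R"
        using uniformly_convex_imp_norm_bounded by blast
      then show "bounded (level2 b y \<gamma>)"
        by (intro bdd_norm[of _ y R]) (auto simp: level2_def bregman_div_def split: if_splits)
    qed
  next
    \<comment> \<open>First type level sets, bounded interior\<close>
    case 28
    then show ?case by (auto simp: level1_def intro: bounded_subset)
  next
    \<comment> \<open>First type level sets, coercive divergence\<close>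
    case 29
    then show ?case
      unfolding level1_def using bounded_sublevel_if_coercive by blast
  next
    \<comment> \<open>Second type level sets, bounded interior: the domain lies in the closure of its interior\<close>
    case 30
    have "bounded (level2 b y \<gamma>)" if "bounded ?U" "y \<in> ?U" for y \<gamma>
    proof -
      have "level2 b y \<gamma> \<subseteq> closure ?U"
        using dom_subset_closure_U that(2) by (auto simp: level2_def)
      then show ?thesis using that(1) bounded_closure bounded_subset by blast
    qed
    then show ?case by blast
  next
    \<comment> \<open>Second type level sets, coercive divergence\<close>
    case 31
    then show ?case
      unfolding level2_def using bounded_sublevel_if_coercive by blast
  next
    \<comment> \<open>Second type level sets, finite dimension, strict convexity on the interior\<close>
    case 32
    then show ?case using fin_dim_strictly_convex_imp_bounded_level2[OF lsc] by blast
  next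
    \<comment> \<open>Second type level sets, finite dimension, strict convexity on the domain\<close>
    case 33
    then show ?case
      using fin_dim_strictly_convex_imp_bounded_level2[OF lsc] U_subset
      unfolding strictly_convex_on_def by blast
  next
    \<comment> \<open>Differences along close sequences\<close>
    case 34
    then show ?case using bregman_div_diff_tendsto_0[OF lsc] by blast
  next
    \<comment> \<open>Differences along weakly convergent sequences\<close>
    case 35
    show ?case
    proof (intro allI ballI impI, elim conjE)
      fix y :: "nat \<Rightarrow> 'a" and z x
      assume *: "weak_to_weakstar_seq_continuous_on ?U grad" "z \<in> ?U" "x \<in> D"
        "\<forall>i. y i \<in> ?U" "weakly_converges y z"
      have "(\<lambda>i. grad (y i) w) \<longlonglongrightarrow> grad z w" for w
        using *(1)[unfolded weak_to_weakstar_seq_continuous_on_def, rule_format, OF *(2)] *(4,5) by blast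
      then show "(\<lambda>i. bregman_div b x (y i) - bregman_div b z (y i)) \<longlonglongrightarrow> bregman_div b x z"
        using * by (intro bregman_div_diff_tendsto) auto
    qed
  next
    \<comment> \<open>Differences along convergent sequences in finite dimension\<close>
    case 36
    show ?case
    proof (intro allI ballI impI, elim conjE)
      fix y :: "nat \<Rightarrow> 'a" and z x
      assume *: "continuous_on ?U grad" "z \<in> ?U" "x \<in> D" "\<forall>i. y i \<in> ?U" "y \<longlonglongrightarrow> z"
      have "(\<lambda>i. grad (y i)) \<longlonglongrightarrow> grad z"
        using * by (intro continuous_on_tendsto_compose[OF *(1,5)]) auto
      then show "(\<lambda>i. bregman_div b x (y i) - bregman_div b z (y i)) \<longlonglongrightarrow> bregman_div b x z"
        using * by (intro bregman_div_diff_tendsto blinfun.tendsto tendsto_const) auto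
    qed
  next
    \<comment> \<open>Strictly increasing gauge, second argument varies\<close>
    case 37
    show ?case
    proof (intro allI ballI impI, elim conjE)
      fix x \<psi> and y :: "nat \<Rightarrow> 'a"
      assume *: "relative_gauge b {x} (S2 \<inter> ?U) \<psi>" "strict_mono_on {0..} \<psi>" "\<psi> 0 = 0"
          "\<forall>i. y i \<in> S2 \<inter> ?U" and lim: "(\<lambda>i. bregman_div b x (y i)) \<longlonglongrightarrow> 0"
      have "(\<lambda>i. norm (x - y i)) \<longlonglongrightarrow> 0"
        using * by (intro tendsto_0_if_minorized[OF lim] strict_gauge_minorant[of "{x}" "S2 \<inter> ?U" \<psi>]) auto
      then show "y \<longlonglongrightarrow> x"
        by (simp add: tendsto_norm_zero_iff LIM_zero_iff norm_minus_commute[of x])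
    qed
  next
    \<comment> \<open>Strictly increasing gauge, first argument varies\<close>
    case 38
    show ?case
    proof (intro allI ballI impI, elim conjE)
      fix y \<psi> and x :: "nat \<Rightarrow> 'a"
      assume *: "y \<in> ?U" "relative_gauge b S1 {y} \<psi>" "strict_mono_on {0..} \<psi>" "\<psi> 0 = 0"
          "\<forall>i. x i \<in> S1" and lim: "(\<lambda>i. bregman_div b (x i) y) \<longlonglongrightarrow> 0"
      have "(\<lambda>i. norm (x i - y)) \<longlonglongrightarrow> 0"
        using * by (intro tendsto_0_if_minorized[OF lim] strict_gauge_minorant[of S1 "{y}" \<psi>]) auto
      then show "x \<longlonglongrightarrow> y"
        by (simp add: tendsto_norm_zero_iff LIM_zero_iff)
    qed
  qed
qed

end
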